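(* Let $\beta>1$ and $\mathbf{L}\in Q^2(\mathbb{D}^2)$. An analytic function $F\colon\mathbb{D}^2\to\mathbb{C}$ has bounded $\mathbf{L}$-index in joint variables if and only if there exists $p\in\mathbb{Z}_+$ such that for every $d\in(0,\beta]$ there exists $\eta(d)\in(0,d)$ such that for each $z^0\in\mathbb{D}^2$, for some $r=r(d,z^0)\in(\eta(d),d)$ and some $k^0=k^0(d,z^0)\le p$, the polynomial $p_{k^0}$ is a main polynomial in the diagonal power expansion of $F$ at $z^0$ on $\mathbb{T}^2\big(z^0,\frac{R}{\mathbf{L}(z^0)}\big)$ with $R=(r,r)$.
   Context: $\mathbb{D}^2=\{(z_1,z_2)\in\mathbb{C}^2:|z_1|<1,|z_2|<1\}$, $\mathbb{Z}_+=\{0,1,2,\dots\}$, $\mathbb{R}_+=[0,\infty)$. $\mathbf{L}(z)=(l_1(z),l_2(z))$, where each $l_j\colon\mathbb{D}^2\to\mathbb{R}_+$ is continuous and satisfies $l_j(z_1,z_2)>\beta/(1-|z_j|)$ for all $(z_1,z_2)\in\mathbb{D}^2$, $j=1,2$. For $z^0\in\mathbb{C}^2$ and $R=(r_1,r_2)\in\mathbb{R}_+^2$: $\mathbb{D}^2[z^0,R]=\{z:|z_j-z_j^0|\le r_j,\ j=1,2\}$, $\mathbb{T}^2(z^0,R)=\{z:|z_j-z_j^0|=r_j,\ j=1,2\}$, $\frac{R}{\mathbf{L}(z^0)}=\big(\frac{r_1}{l_1(z^0)},\frac{r_2}{l_2(z^0)}\big)$. $F^{(p,q)}=\frac{\partial^{p+q}F}{\partial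 z_1^p\partial z_2^q}$. An analytic $F\colon\mathbb{D}^2\to\mathbb{C}$ has bounded $\mathbf{L}$-index in joint variables if there is $n_0\in\mathbb{Z}_+$ such that for all $z\in\mathbb{D}^2$ and all $(p_1,p_2)\in\mathbb{Z}_+^2$: $\frac{|F^{(p_1,p_2)}(z)|}{p_1!p_2!\,l_1^{p_1}(z)l_2^{p_2}(z)}\le\max\{\frac{|F^{(k_1,k_2)}(z)|}{k_1!k_2!\,l_1^{k_1}(z)l_2^{k_2}(z)}:0\le k_1+k_2\le n_0\}$. $Q^2(\mathbb{D}^2)$ is the class of such $\mathbf{L}$ for which, for all $R=(r_1,r_2)\in[0,\beta]^2$ and $j=1,2$, $0<\lambda_{1,j}(R)\le\lambda_{2,j}(R)<\infty$, where $\lambda_{1,j}(R)=\inf_{z^0\in\mathbb{D}^2}\inf\{l_j(z)/l_j(z^0): z\in\mathbb{D}^2[z^0,R/\mathbf{L}(z^0)]\}$ and $\lambda_{2,j}(R)=\sup_{z^0\in\mathbb{D}^2}\sup\{l_j(z)/l_j(z^0): z\in\mathbb{D}^2[z^0,R/\mathbf{L}(z^0)]\}$. Diagonal power expansion: for $z^0\in\mathbb{D}^2$ write $F(z)=\sum_{k=0}^\infty p_k(z_1-z_1^0,z_2-z_2^0)$, where $p_k(w_1,w_2)=\sum_{j_1+j_2=k}b_{j_1,j_2}w_1^{j_1}w_2^{j_2}$ and $b_{j_1,j_2}=\frac{F^{(j_1,j_2)}(z^0)}{j_1!j_2!}$. For $R=(r_1,r_2)$, the polynomial $p_{k^0}$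 ($k^0\in\mathbb{Z}_+$) is a main polynomial of this expansion on $\mathbb{T}^2(z^0,R)$ if for every $z\in\mathbb{T}^2(z^0,R)$: $\big|\sum_{k\ne k^0}p_k(z_1-z_1^0,z_2-z_2^0)\big|\le\frac12\max\{|b_{j_1,j_2}|r_1^{j_1}r_2^{j_2}: j_1+j_2=k^0\}$. *)

theory Defs
  imports "HOL-Analysis.Analysis"
begin

definition bidisc :: "(complex \<times> complex) set" where
  "bidisc = {z. norm (fst z) < 1 \<and> norm (snd z) < 1}"

definition cpolydisc :: "complex \<times> complex \<Rightarrow> real \<times> real \<Rightarrow> (complex \<times> complex) set" where
  "cpolydisc z0 R = {z. norm (fst z - fst z0) \<le> fst R \<and> norm (snd z - snd z0) \<le> snd R}"

definition torus2 :: "complex \<times> complex \<Rightarrow> real \<times> real \<Rightarrow> (complex \<times> complex) set" where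
  "torus2 z0 R = {z. norm (fst z - fst z0) = fst R \<and> norm (snd z - snd z0) = snd R}"

text \<open>Analytic (holomorphic) on an open set of C^2: continuous and holomorphic in each
  variable separately (equivalent to local power series representability).\<close>
definition analytic2 :: "(complex \<times> complex \<Rightarrow> complex) \<Rightarrow> (complex \<times> complex) set \<Rightarrow> bool" where
  "analytic2 F S \<longleftrightarrow> continuous_on S F \<and>
     (\<forall>z\<in>S. (\<lambda>w. F (w, snd z)) holomorphic_on {w. (w, snd z) \<in> S}
           \<and> (\<lambda>w. F (fst z, w)) holomorphic_on {w. (fst z, w) \<in> S})"

definition pderiv2 :: "(complex \<times> complex \<Rightarrow> complex) \<Rightarrow> nat \<Rightarrow> nat \<Rightarrow> complex \<times> complex \<Rightarrow> complex" where
  "pderiv2 F p q z = (deriv ^^ p) (\<lambda>w1. (deriv ^^ q) (\<lambda>w2. F (w1, w2)) (snd z)) (fst z)"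

definition bounded_L_index_joint ::
  "(complex \<times> complex \<Rightarrow> complex) \<Rightarrow> (complex \<times> complex \<Rightarrow> real) \<Rightarrow> (complex \<times> complex \<Rightarrow> real) \<Rightarrow> bool" where
  "bounded_L_index_joint F l1 l2 \<longleftrightarrow>
     (\<exists>n0::nat. \<forall>z\<in>bidisc. \<forall>p1 p2::nat.
        norm (pderiv2 F p1 p2 z) / (fact p1 * fact p2 * l1 z ^ p1 * l2 z ^ p2)
        \<le> Max ((\<lambda>(k1, k2). norm (pderiv2 F k1 k2 z) / (fact k1 * fact k2 * l1 z ^ k1 * l2 z ^ k2))
                 ` {(k1, k2). k1 + k2 \<le> n0}))"

text \<open>lambda_{1,j}(R) and lambda_{2,j}(R), as extended reals; l selects l_j.\<close>
definition lambda1 :: "(complex \<times> complex \<Rightarrow> real) \<Rightarrow> (complex \<times> complex \<Rightarrow> real) \<Rightarrow> (complex \<times> complex \<Rightarrow> real) \<Rightarrow> real \<times> real \<Rightarrow> ereal" where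
  "lambda1 l l1 l2 R = (INF z0\<in>bidisc. INF z\<in>cpolydisc z0 (fst R / l1 z0, snd R / l2 z0). ereal (l z / l z0))"

definition lambda2 :: "(complex \<times> complex \<Rightarrow> real) \<Rightarrow> (complex \<times> complex \<Rightarrow> real) \<Rightarrow> (complex \<times> complex \<Rightarrow> real) \<Rightarrow> real \<times> real \<Rightarrow> ereal" where
  "lambda2 l l1 l2 R = (SUP z0\<in>bidisc. SUP z\<in>cpolydisc z0 (fst R / l1 z0, snd R / l2 z0). ereal (l z / l z0))"

definition Q2 :: "real \<Rightarrow> (complex \<times> complex \<Rightarrow> real) \<Rightarrow> (complex \<times> complex \<Rightarrow> real) \<Rightarrow> bool" where
  "Q2 \<beta> l1 l2 \<longleftrightarrow> (\<forall>r1 r2. 0 \<le> r1 \<and> r1 \<le> \<beta> \<and> 0 \<le> r2 \<and> r2 \<le> \<beta> \<longrightarrow>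
      (\<forall>l\<in>{l1, l2}. 0 < lambda1 l l1 l2 (r1, r2) \<and> lambda1 l l1 l2 (r1, r2) \<le> lambda2 l l1 l2 (r1, r2)
                     \<and> lambda2 l l1 l2 (r1, r2) < \<infinity>))"

definition tcoeff :: "(complex \<times> complex \<Rightarrow> complex) \<Rightarrow> complex \<times> complex \<Rightarrow> nat \<Rightarrow> nat \<Rightarrow> complex" where
  "tcoeff F z0 j1 j2 = pderiv2 F j1 j2 z0 / (fact j1 * fact j2)"

definition diag_poly :: "(complex \<times> complex \<Rightarrow> complex) \<Rightarrow> complex \<times> complex \<Rightarrow> nat \<Rightarrow> complex \<times> complex \<Rightarrow> complex" where
  "diag_poly F z0 k w = (\<Sum>j1\<le>k. tcoeff F z0 j1 (k - j1) * fst w ^ j1 * snd w ^ (k - j1))"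

definition main_polynomial :: "(complex \<times> complex \<Rightarrow> complex) \<Rightarrow> complex \<times> complex \<Rightarrow> real \<times> real \<Rightarrow> nat \<Rightarrow> bool" where
  "main_polynomial F z0 R k0 \<longleftrightarrow>
     (\<forall>z\<in>torus2 z0 R.
        norm (\<Sum>k. if k = k0 then 0 else diag_poly F z0 k (fst z - fst z0, snd z - snd z0))
        \<le> 1/2 * Max ((\<lambda>j1. norm (tcoeff F z0 j1 (k0 - j1)) * fst R ^ j1 * snd R ^ (k0 - j1)) ` {..k0}))"

end

theory Submission
  imports Defs "HOL-Complex_Analysis.Complex_Analysis"
begin

text \<open>
  Let $A_k(z)$ be the largest of the scaled Taylor coefficients
  $|b_{i,j}(z)| / (l_1(z)^i l_2(z)^j)$ with $i + j = k$.

  If the index is at most $n$, every $A_k$ is at most some $A_m$ with $m \le n$. Hence for $x \le 1$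
  some $A_m x^m$ with $m \le n$ is the largest of all $A_k x^k$. Among $n + 2$ radii in geometric
  progression two have the same dominant index $k^0$, and strictly between them the terms
  $A_k r^k$ decay geometrically in $|k - k^0|$, which makes $p_{k^0}$ a main polynomial.

  Conversely, take $d = 1$. By Cauchy's inequalities a main polynomial of degree at most $p$ on a
  torus of scaled radius $r < 1$ gives $A_k r^k \le M(z) := \max_{m \le p} A_m(z)$ for all $k$. Hence
  $F$ is bounded by $9 M(z)$ on the polydisc of scaled radius $2r/3$, and Cauchy's inequalities
  give $M(w) \le K M(z)$ for $w$ at scaled distance at most $\eta/3$. A chain of boundedly many
  such steps reaches every point at scaled distance at most $\beta$, so $|F| \le K^N M(z)$ there
  and $A_k(z) \le \beta^{-k} K^N M(z)$. Since $\beta > 1$, this is at most $M(z)$ for large $k$.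
\<close>

section \<open>Functions of one variable\<close>

lemma Taylor_coeff_Cauchy_inequality:
  assumes "f holomorphic_on cball z \<rho>" "0 < \<rho>" "\<And>x. norm (x - z) = \<rho> \<Longrightarrow> norm (f x) \<le> B"
  shows "norm ((deriv ^^ n) f z / fact n) * \<rho> ^ n \<le> B"
proof -
  have "f holomorphic_on ball z \<rho>" "continuous_on (cball z \<rho>) f"
    using assms(1) ball_subset_cball holomorphic_on_subset holomorphic_on_imp_continuous_on by blast+
  then have "norm ((deriv ^^ n) f z) \<le> fact n * B / \<rho> ^ n"
    using assms(2,3) by (intro Cauchy_inequality) (auto simp: norm_minus_commute)
  then show ?thesis
    using \<open>0 < \<rho>\<close> by (simp add: norm_divide field_simps)
qed

lemma Taylor_coeff_Cauchy_inequality_on_cball: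
  assumes f: "f holomorphic_on cball z (r + \<rho>)" and "0 < \<rho>"
    and M: "\<And>x. x \<in> cball z (r + \<rho>) \<Longrightarrow> norm (f x) \<le> M" and x: "x \<in> cball z r"
  shows "norm ((deriv ^^ n) f x / fact n) * \<rho> ^ n \<le> M"
proof -
  have "cball x \<rho> \<subseteq> cball z (r + \<rho>)"
    using x by (simp add: cball_subset_cball_iff dist_commute)
  then have "f holomorphic_on cball x \<rho>" "\<And>y. norm (y - x) = \<rho> \<Longrightarrow> norm (f y) \<le> M"
    using f M by (auto simp: subset_iff dist_norm norm_minus_commute elim: holomorphic_on_subset)
  then show ?thesis
    using \<open>0 < \<rho>\<close> by (intro Taylor_coeff_Cauchy_inequality)
qed

lemma eval_fps_Cauchy_inequality:
  fixes f :: "complex fps"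
  assumes "0 < \<rho>" "ereal \<rho> < fps_conv_radius f" "\<And>u. norm u = \<rho> \<Longrightarrow> norm (eval_fps f u) \<le> B"
  shows "norm (fps_nth f n) * \<rho> ^ n \<le> B"
proof -
  have "cball (0 :: complex) \<rho> \<subseteq> eball 0 (fps_conv_radius f)"
  proof
    fix x :: complex assume "x \<in> cball 0 \<rho>"
    then have "ereal (norm x) \<le> ereal \<rho>" by simp
    also note assms(2)
    finally show "x \<in> eball 0 (fps_conv_radius f)" by simp
  qed
  then have "norm ((deriv ^^ n) (eval_fps f) 0 / fact n) * \<rho> ^ n \<le> B"
    using assms by (intro Taylor_coeff_Cauchy_inequality holomorphic_on_eval_fps) auto
  moreover have "0 < fps_conv_radius f"
    using assms(1,2) by (auto intro: less_trans[of 0 "ereal \<rho>"])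
  ultimately show ?thesis
    by (simp add: fps_nth_conv_deriv)
qed

lemma holomorphic_Taylor_has_sum:
  assumes f: "f holomorphic_on ball z r" and u: "norm u < r"
  shows "((\<lambda>n. (deriv ^^ n) f z / fact n * u ^ n) has_sum f (z + u)) UNIV"
proof -
  have sums: "(\<lambda>n. (deriv ^^ n) f z / fact n * x ^ n) sums f (z + x)" if "norm x < r" for x
    using holomorphic_power_series[OF f, of "z + x"] that by (simp add: dist_norm)
  obtain t where t: "norm u < t" "t < r"
    using dense[OF u] by blast
  then have "norm u < norm (of_real t :: complex)" "norm (of_real t :: complex) < r"
    using norm_ge_zero[of u] by (auto simp: abs_if simp del: norm_ge_zero)
  then show ?thesis
    using sums u
    by (intro norm_summable_imp_has_sum powser_insidea[of _ "of_real t"]) (auto simp: sums_iff)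
qed

lemma norm_difference_quotient_minus_deriv_le:
  assumes f: "f holomorphic_on cball z (2 * \<rho>)" and "0 < \<rho>"
    and M: "\<And>x. x \<in> cball z (2 * \<rho>) \<Longrightarrow> norm (f x) \<le> M"
    and h: "norm h \<le> \<rho>" "h \<noteq> 0"
  shows "norm ((f (z + h) - f z) / h - deriv f z) \<le> 2 * M / \<rho>\<^sup>2 * norm h"
proof -
  have deriv: "((deriv ^^ i) f has_field_derivative (deriv ^^ Suc i) f x) (at x within cball z \<rho>)"
    if "x \<in> cball z \<rho>" for i x
  proof -
    have "f holomorphic_on ball z (2 * \<rho>)"
      using f ball_subset_cball by (rule holomorphic_on_subset)
    then have "(deriv ^^ i) f holomorphic_on ball z (2 * \<rho>)"
      by (intro holomorphic_higher_deriv open_ball)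
    moreover have "x \<in> ball z (2 * \<rho>)"
      using that \<open>0 < \<rho>\<close> by simp
    ultimately show ?thesis
      using holomorphic_derivI[OF _ open_ball] by simp
  qed
  have deriv2: "norm ((deriv ^^ 2) f x) \<le> 2 * M / \<rho>\<^sup>2" if "x \<in> cball z \<rho>" for x
    using Taylor_coeff_Cauchy_inequality_on_cball[of f z \<rho> \<rho> M x 2] f M \<open>0 < \<rho>\<close> that
    by (simp add: norm_divide pos_le_divide_eq)
  have "norm ((deriv ^^ 0) f (z + h) - (\<Sum>i\<le>1. (deriv ^^ i) f z * (z + h - z) ^ i / fact i))
      \<le> 2 * M / \<rho>\<^sup>2 * norm (z + h - z) ^ Suc 1 / fact 1"
  proof (rule complex_Taylor[of "cball z \<rho>"])
    show "norm ((deriv ^^ Suc 1) f x) \<le> 2 * M / \<rho>\<^sup>2" if "x \<in> cball z \<rho>" for x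
      using deriv2[OF that] by (simp add: numeral_2_eq_2)
  qed (use deriv \<open>0 < \<rho>\<close> h in \<open>auto simp: dist_norm\<close>)
  then have "norm (f (z + h) - f z - deriv f z * h) \<le> 2 * M / \<rho>\<^sup>2 * norm h * norm h"
    by (simp add: diff_diff_eq power2_eq_square)
  moreover have "(f (z + h) - f z) / h - deriv f z = (f (z + h) - f z - deriv f z * h) / h"
    using h(2) by (simp add: field_simps)
  ultimately show ?thesis
    using h(2) by (simp add: norm_divide pos_divide_le_eq)
qed

section \<open>Analytic functions of two variables\<close>

lemma cpolydisc_eq_Times: "cpolydisc z R = cball (fst z) (fst R) \<times> cball (snd z) (snd R)"
  by (auto simp: cpolydisc_def dist_norm norm_minus_commute)

lemma compact_cpolydisc: "compact (cpolydisc z R)"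
  by (simp add: cpolydisc_eq_Times compact_Times)

lemma open_contains_cpolydisc:
  assumes "open S" "z \<in> S" and R: "0 < fst R" "0 < snd R"
  obtains d where "0 < d" "cpolydisc z (d *\<^sub>R R) \<subseteq> S"
proof -
  obtain A B where AB: "open A" "open B" "z \<in> A \<times> B" "A \<times> B \<subseteq> S"
    using assms by (metis open_prod_elim)
  then obtain a b where ab: "0 < a" "cball (fst z) a \<subseteq> A" "0 < b" "cball (snd z) b \<subseteq> B"
    by (metis mem_Times_iff open_contains_cball)
  define d where "d = min (a / fst R) (b / snd R)"
  have "d * fst R \<le> a" "d * snd R \<le> b"
    using R by (simp_all add: d_def min_def field_simps)
  then have "cpolydisc z (d *\<^sub>R R) \<subseteq> A \<times> B"
    using ab(2,4) by (auto simp: cpolydisc_eq_Times)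
  moreover have "0 < d"
    using R ab(1,3) by (simp add: d_def)
  ultimately show ?thesis
    using AB(4) by (intro that[of d]) auto
qed

lemma analytic2_holomorphic_fst:
  assumes "analytic2 F S" "A \<times> {y} \<subseteq> S"
  shows "(\<lambda>w. F (w, y)) holomorphic_on A"
proof (cases "A = {}")
  case False
  then obtain x where "(x, y) \<in> S" using assms(2) by blast
  then have "(\<lambda>w. F (w, y)) holomorphic_on {w. (w, y) \<in> S}"
    using assms(1) by (force simp: analytic2_def)
  then show ?thesis
    using assms(2) by (auto elim: holomorphic_on_subset)
qed (simp add: holomorphic_on_def)

lemma analytic2_holomorphic_snd:
  assumes "analytic2 F S" "{x} \<times> A \<subseteq> S"
  shows "(\<lambda>w. F (x, w)) holomorphic_on A"
proof (cases "A = {}")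
  case False
  then obtain y where "(x, y) \<in> S" using assms(2) by blast
  then have "(\<lambda>w. F (x, w)) holomorphic_on {w. (x, w) \<in> S}"
    using assms(1) by (force simp: analytic2_def)
  then show ?thesis
    using assms(2) by (auto elim: holomorphic_on_subset)
qed (simp add: holomorphic_on_def)

lemma analytic2_bounded_on_cpolydisc:
  assumes "analytic2 F S" "cpolydisc z R \<subseteq> S"
  obtains M where "\<And>w. w \<in> cpolydisc z R \<Longrightarrow> norm (F w) \<le> M"
proof -
  have "continuous_on (cpolydisc z R) F"
    using assms continuous_on_subset by (auto simp: analytic2_def)
  then have "bounded (F ` cpolydisc z R)"
    by (intro compact_imp_bounded compact_continuous_image compact_cpolydisc)
  then show ?thesis
    using that by (metis bounded_iff image_eqI)
qed

lemma open_sections: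
  assumes "open S"
  shows "open {x. (x, y) \<in> S}" and "open {y. (x, y) \<in> S}"
  using open_vimage[OF assms, of "\<lambda>x. (x, y)"] open_vimage[OF assms, of "\<lambda>y. (x, y)"]
  by (simp_all add: vimage_def continuous_intros)

definition diff_quotient_snd ::
    "(complex \<times> complex \<Rightarrow> complex) \<Rightarrow> complex \<Rightarrow> complex \<times> complex \<Rightarrow> complex" where
  "diff_quotient_snd F h w = (F (fst w, snd w + h) - F w) / h"

definition deriv_snd :: "(complex \<times> complex \<Rightarrow> complex) \<Rightarrow> complex \<times> complex \<Rightarrow> complex" where
  "deriv_snd F w = deriv (\<lambda>y. F (fst w, y)) (snd w)"

lemma norm_diff_quotient_snd_minus_deriv_snd_le:
  assumes F: "analytic2 F S" and S: "cpolydisc z (r, 3 * \<rho>) \<subseteq> S" and "0 < \<rho>"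
    and M: "\<And>w. w \<in> cpolydisc z (r, 3 * \<rho>) \<Longrightarrow> norm (F w) \<le> M"
    and w: "w \<in> cpolydisc z (r, \<rho>)" and h: "norm h \<le> \<rho>" "h \<noteq> 0"
  shows "norm (diff_quotient_snd F h w - deriv_snd F w) \<le> 2 * M / \<rho>\<^sup>2 * norm h"
proof -
  have "cball (snd w) (2 * \<rho>) \<subseteq> cball (snd z) (3 * \<rho>)"
    using w by (simp add: cpolydisc_eq_Times mem_Times_iff cball_subset_cball_iff dist_commute)
  then have "{fst w} \<times> cball (snd w) (2 * \<rho>) \<subseteq> cpolydisc z (r, 3 * \<rho>)"
    using w by (auto simp: cpolydisc_eq_Times)
  then have "(\<lambda>y. F (fst w, y)) holomorphic_on cball (snd w) (2 * \<rho>)"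
    "\<And>y. y \<in> cball (snd w) (2 * \<rho>) \<Longrightarrow> norm (F (fst w, y)) \<le> M"
    using S M by (blast intro: analytic2_holomorphic_snd[OF F])+
  from norm_difference_quotient_minus_deriv_le[OF this(1) \<open>0 < \<rho>\<close> this(2) h] show ?thesis
    by (simp add: diff_quotient_snd_def deriv_snd_def)
qed

lemma uniform_limit_diff_quotient_snd:
  assumes F: "analytic2 F S" and S: "cpolydisc z (r, 3 * \<rho>) \<subseteq> S" and "0 < \<rho>"
  shows "uniform_limit (cpolydisc z (r, \<rho>)) (diff_quotient_snd F) (deriv_snd F) (at 0)"
proof (rule uniform_limitI)
  obtain M where M: "\<And>w. w \<in> cpolydisc z (r, 3 * \<rho>) \<Longrightarrow> norm (F w) \<le> M"
    using analytic2_bounded_on_cpolydisc[OF F S] by blast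
  note error = norm_diff_quotient_snd_minus_deriv_snd_le[OF F S \<open>0 < \<rho>\<close> M]
  have "((\<lambda>h. 2 * M / \<rho>\<^sup>2 * norm h) \<longlongrightarrow> 2 * M / \<rho>\<^sup>2 * norm (0::complex)) (at (0::complex))"
    by (intro tendsto_intros)
  then have lim: "((\<lambda>h. 2 * M / \<rho>\<^sup>2 * norm h) \<longlongrightarrow> 0) (at (0::complex))" by simp
  fix e :: real assume "0 < e"
  with lim have "\<forall>\<^sub>F h::complex in at 0. 2 * M / \<rho>\<^sup>2 * norm h < e"
    by (rule order_tendstoD)
  moreover have "\<forall>\<^sub>F h::complex in at 0. norm h < \<rho>"
    using \<open>0 < \<rho>\<close> by (auto simp: eventually_at dist_norm)
  moreover have "\<forall>\<^sub>F h::complex in at 0. h \<noteq> 0"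
    by (simp add: eventually_at_filter)
  ultimately show "\<forall>\<^sub>F h in at 0. \<forall>w\<in>cpolydisc z (r, \<rho>).
      dist (diff_quotient_snd F h w) (deriv_snd F w) < e"
    by eventually_elim (auto simp: dist_norm intro: le_less_trans[OF error])
qed

lemma diff_quotient_snd_analytic_on_cpolydisc:
  assumes F: "analytic2 F S" and S: "cpolydisc z (r, 3 * \<rho>) \<subseteq> S"
    and r: "0 \<le> r" and h: "norm h \<le> \<rho>" "h \<noteq> 0"
  shows "continuous_on (cpolydisc z (r, \<rho>)) (diff_quotient_snd F h)"
    and "(\<lambda>x. diff_quotient_snd F h (x, snd z)) holomorphic_on cball (fst z) r"
proof -
  have "0 \<le> \<rho>" using h(1) norm_ge_zero order_trans by blast
  have shift: "(fst w, snd w + k) \<in> S" if "w \<in> cpolydisc z (r, \<rho>)" "norm k \<le> \<rho>" for w k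
  proof (rule subsetD[OF S])
    show "(fst w, snd w + k) \<in> cpolydisc z (r, 3 * \<rho>)"
      using that \<open>0 \<le> \<rho>\<close> norm_triangle_ineq[of "snd w - snd z" k]
      by (simp add: cpolydisc_def algebra_simps)
  qed
  have cont: "continuous_on (cpolydisc z (r, \<rho>)) (\<lambda>w. F (fst w, snd w + k))" if "norm k \<le> \<rho>" for k
  proof (rule continuous_on_compose2[of S F])
    show "continuous_on S F" using F by (simp add: analytic2_def)
  qed (use shift that in \<open>auto intro!: continuous_intros\<close>)
  show "continuous_on (cpolydisc z (r, \<rho>)) (diff_quotient_snd F h)"
    unfolding diff_quotient_snd_def[abs_def] using cont[of h] cont[of 0] h \<open>0 \<le> \<rho>\<close>
    by (auto intro!: continuous_on_divide continuous_on_diff)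
  have hol: "(\<lambda>x. F (x, snd z + k)) holomorphic_on cball (fst z) r" if "norm k \<le> \<rho>" for k
    using shift[of _ k] that \<open>0 \<le> \<rho>\<close> r
    by (intro analytic2_holomorphic_fst[OF F]) (fastforce simp: cpolydisc_eq_Times)
  show "(\<lambda>x. diff_quotient_snd F h (x, snd z)) holomorphic_on cball (fst z) r"
    unfolding diff_quotient_snd_def using hol[of h] hol[of 0] h \<open>0 \<le> \<rho>\<close>
    by (auto intro!: holomorphic_intros)
qed

lemma deriv_snd_analytic_on_cpolydisc:
  assumes F: "analytic2 F S" and S: "cpolydisc z (r, 3 * \<rho>) \<subseteq> S" and "0 \<le> r" "0 < \<rho>"
  shows "continuous_on (cpolydisc z (r, \<rho>)) (deriv_snd F)"
    and "(\<lambda>x. deriv_snd F (x, snd z)) holomorphic_on ball (fst z) r"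
proof -
  note quotient = diff_quotient_snd_analytic_on_cpolydisc[OF F S \<open>0 \<le> r\<close>]
  have lim: "uniform_limit (cpolydisc z (r, \<rho>)) (diff_quotient_snd F) (deriv_snd F) (at 0)"
    by (rule uniform_limit_diff_quotient_snd[OF F S \<open>0 < \<rho>\<close>])
  have small: "\<forall>\<^sub>F h::complex in at 0. norm h \<le> \<rho> \<and> h \<noteq> 0"
    unfolding eventually_at by (rule exI[of _ \<rho>]) (use \<open>0 < \<rho>\<close> in \<open>auto simp: dist_norm\<close>)
  show "continuous_on (cpolydisc z (r, \<rho>)) (deriv_snd F)"
  proof (rule uniform_limit_theorem[OF _ lim])
    from small show "\<forall>\<^sub>F h in at 0. continuous_on (cpolydisc z (r, \<rho>)) (diff_quotient_snd F h)"
      by eventually_elim (rule quotient, auto)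
  qed simp
  have lim_fst: "uniform_limit (cball (fst z) r) (\<lambda>h x. diff_quotient_snd F h (x, snd z))
      (\<lambda>x. deriv_snd F (x, snd z)) (at 0)"
    by (rule uniform_limit_compose'[OF lim]) (use \<open>0 < \<rho>\<close> in \<open>simp add: cpolydisc_eq_Times\<close>)
  from small have "\<forall>\<^sub>F h in at 0.
      continuous_on (cball (fst z) r) (\<lambda>x. diff_quotient_snd F h (x, snd z)) \<and>
      (\<lambda>x. diff_quotient_snd F h (x, snd z)) holomorphic_on ball (fst z) r"
    by eventually_elim (auto intro!: holomorphic_on_imp_continuous_on
        holomorphic_on_subset[OF _ ball_subset_cball] quotient(2))
  from this lim_fst show "(\<lambda>x. deriv_snd F (x, snd z)) holomorphic_on ball (fst z) r"
    by (rule holomorphic_uniform_limit) auto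
qed

lemma analytic2_deriv_snd:
  assumes F: "analytic2 F S" and S: "open S"
  shows "analytic2 (deriv_snd F) S"
  unfolding analytic2_def
proof (intro conjI ballI)
  have local_radius: "\<exists>d>0. cpolydisc z (d, 3 * d) \<subseteq> S" if z: "z \<in> S" for z
    using open_contains_cpolydisc[OF S z, of "(1, 3)"] by (auto simp: mult.commute)
  show "continuous_on S (deriv_snd F)"
  proof (rule continuous_at_imp_continuous_on, rule ballI)
    fix z assume "z \<in> S"
    then obtain d where d: "0 < d" "cpolydisc z (d, 3 * d) \<subseteq> S"
      using local_radius by blast
    have "z \<in> interior (cpolydisc z (d, d))"
      using d(1) by (simp add: cpolydisc_eq_Times interior_Times mem_Times_iff)
    moreover have "continuous_on (cpolydisc z (d, d)) (deriv_snd F)"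
      using d(1) by (intro deriv_snd_analytic_on_cpolydisc(1)[OF F d(2)]) auto
    ultimately show "isCont (deriv_snd F) z"
      by (rule continuous_on_interior[rotated])
  qed
  fix z assume z: "z \<in> S"
  show "(\<lambda>x. deriv_snd F (x, snd z)) holomorphic_on {x. (x, snd z) \<in> S}"
    unfolding holomorphic_on_def
  proof
    fix x assume "x \<in> {x. (x, snd z) \<in> S}"
    then obtain d where d: "0 < d" "cpolydisc (x, snd z) (d, 3 * d) \<subseteq> S"
      using local_radius by blast
    have "(\<lambda>x. deriv_snd F (x, snd z)) holomorphic_on ball x d"
      using deriv_snd_analytic_on_cpolydisc(2)[OF F d(2)] d(1) by simp
    then have "(\<lambda>x. deriv_snd F (x, snd z)) field_differentiable (at x)"
      using d(1) by (intro holomorphic_on_imp_differentiable_at) auto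
    then show "(\<lambda>x. deriv_snd F (x, snd z)) field_differentiable (at x within {x. (x, snd z) \<in> S})"
      by (rule field_differentiable_at_within)
  qed
  have "deriv (\<lambda>y. F (fst z, y)) holomorphic_on {y. (fst z, y) \<in> S}"
    using F z by (intro holomorphic_deriv open_sections S) (auto simp: analytic2_def)
  then show "(\<lambda>y. deriv_snd F (fst z, y)) holomorphic_on {y. (fst z, y) \<in> S}"
    by (simp add: deriv_snd_def[abs_def])
qed

lemma analytic2_higher_deriv_snd:
  assumes "analytic2 F S" "open S"
  shows "analytic2 (\<lambda>w. (deriv ^^ q) (\<lambda>y. F (fst w, y)) (snd w)) S"
proof (induction q)
  case 0
  then show ?case using assms(1) by simp
next
  case (Suc q)
  from analytic2_deriv_snd[OF this assms(2)] show ?case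
    by (simp add: deriv_snd_def[abs_def])
qed

section \<open>Taylor expansion\<close>

definition snd_Taylor_coeff ::
    "(complex \<times> complex \<Rightarrow> complex) \<Rightarrow> complex \<Rightarrow> nat \<Rightarrow> complex \<Rightarrow> complex" where
  "snd_Taylor_coeff F y q x = (deriv ^^ q) (\<lambda>v. F (x, v)) y / fact q"

lemma holomorphic_on_snd_Taylor_coeff:
  assumes "analytic2 F S" "open S" "A \<times> {y} \<subseteq> S"
  shows "snd_Taylor_coeff F y q holomorphic_on A"
proof -
  have "(\<lambda>x. (deriv ^^ q) (\<lambda>v. F (x, v)) y) holomorphic_on A"
    using analytic2_holomorphic_fst[OF analytic2_higher_deriv_snd[OF assms(1,2)] assms(3), of q]
    by simp
  then show ?thesis
    unfolding snd_Taylor_coeff_def by (intro holomorphic_intros) auto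
qed

lemma tcoeff_eq_deriv_snd_Taylor_coeff:
  assumes F: "analytic2 F S" and S: "open S" "z \<in> S"
  shows "tcoeff F z p q = (deriv ^^ p) (snd_Taylor_coeff F (snd z) q) (fst z) / fact p"
proof -
  have "snd_Taylor_coeff F (snd z) q holomorphic_on {x. (x, snd z) \<in> S}"
    by (rule holomorphic_on_snd_Taylor_coeff[OF F S(1)]) auto
  then have "(deriv ^^ p) (\<lambda>x. fact q * snd_Taylor_coeff F (snd z) q x) (fst z)
      = fact q * (deriv ^^ p) (snd_Taylor_coeff F (snd z) q) (fst z)"
    using S by (intro higher_deriv_cmult[OF _ _ open_sections(1)]) auto
  then show ?thesis
    by (simp add: tcoeff_def pderiv2_def snd_Taylor_coeff_def[abs_def])
qed

definition monomial_size ::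
    "(complex \<times> complex \<Rightarrow> complex) \<Rightarrow> complex \<times> complex \<Rightarrow> real \<times> real \<Rightarrow> nat \<Rightarrow> nat \<Rightarrow> real" where
  "monomial_size F z R p q = norm (tcoeff F z p q) * fst R ^ p * snd R ^ q"

lemma monomial_size_Cauchy_inequality:
  assumes F: "analytic2 F S" and S: "open S" "cpolydisc z R \<subseteq> S" and R: "0 < fst R" "0 < snd R"
    and le: "\<And>w. w \<in> torus2 z R \<Longrightarrow> norm (F w) \<le> B"
  shows "monomial_size F z R p q \<le> B"
proof -
  have fst_bound: "norm (snd_Taylor_coeff F (snd z) q x) \<le> B / snd R ^ q"
    if x: "norm (x - fst z) = fst R" for x
  proof -
    have "norm (snd_Taylor_coeff F (snd z) q x) * snd R ^ q \<le> B"
      unfolding snd_Taylor_coeff_def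
    proof (rule Taylor_coeff_Cauchy_inequality[OF _ R(2)])
      show "(\<lambda>v. F (x, v)) holomorphic_on cball (snd z) (snd R)"
        using x S(2) by (intro analytic2_holomorphic_snd[OF F])
          (auto simp: cpolydisc_eq_Times dist_norm norm_minus_commute)
    qed (use x le in \<open>auto simp: torus2_def\<close>)
    then show ?thesis using R by (simp add: pos_le_divide_eq)
  qed
  have "z \<in> S" using S(2) R by (auto simp: cpolydisc_def)
  moreover have "snd_Taylor_coeff F (snd z) q holomorphic_on cball (fst z) (fst R)"
    using S(2) R
    by (intro holomorphic_on_snd_Taylor_coeff[OF F S(1)]) (auto simp: cpolydisc_eq_Times)
  ultimately have "norm (tcoeff F z p q) * fst R ^ p \<le> B / snd R ^ q"
    using fst_bound R Taylor_coeff_Cauchy_inequality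
    by (simp add: tcoeff_eq_deriv_snd_Taylor_coeff[OF F S(1)])
  then show ?thesis
    using R by (simp add: monomial_size_def pos_le_divide_eq)
qed

lemma summable_on_geometric_product:
  fixes x y :: real
  assumes "0 \<le> x" "x < 1" "0 \<le> y" "y < 1"
  shows "(\<lambda>(p, q). x ^ p * y ^ q) summable_on (UNIV :: (nat \<times> nat) set)"
proof -
  have geometric: "((\<lambda>n::nat. t ^ n) has_sum (1 / (1 - t))) UNIV" if "0 \<le> t" "t < 1" for t :: real
    using that by (intro sums_nonneg_imp_has_sum) (auto intro: geometric_sums)
  have "(\<lambda>(p, q). x ^ p * y ^ q) summable_on (UNIV \<times> UNIV :: (nat \<times> nat) set)"
  proof (rule summable_on_SigmaI)
    show "((\<lambda>q. case (p, q) of (p, q) \<Rightarrow> x ^ p * y ^ q) has_sum (x ^ p * (1 / (1 - y)))) UNIV" for p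
      using has_sum_cmult_right[OF geometric[of y], of "x ^ p"] assms by simp
    show "(\<lambda>p. x ^ p * (1 / (1 - y))) summable_on UNIV"
      using assms by (intro summable_on_cmult_left has_sum_imp_summable[OF geometric])
  qed (use assms in auto)
  then show ?thesis by simp
qed

lemma Taylor_monomials_summable_on:
  assumes F: "analytic2 F S" and S: "open S" "cpolydisc z R \<subseteq> S"
    and u: "norm u < fst R" and v: "norm v < snd R"
  shows "(\<lambda>(p, q). tcoeff F z p q * u ^ p * v ^ q) summable_on UNIV"
proof -
  have R: "0 < fst R" "0 < snd R"
    using u v norm_ge_zero[of u] norm_ge_zero[of v] by linarith+
  obtain M where M: "\<And>w. w \<in> cpolydisc z R \<Longrightarrow> norm (F w) \<le> M"
    using analytic2_bounded_on_cpolydisc[OF F S(2)] by blast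
  have "(\<lambda>x. M * (case x of (p, q) \<Rightarrow> (norm u / fst R) ^ p * (norm v / snd R) ^ q)) summable_on UNIV"
    using u v R by (intro summable_on_cmult_right summable_on_geometric_product) auto
  moreover have "norm (case x of (p, q) \<Rightarrow> tcoeff F z p q * u ^ p * v ^ q)
      \<le> M * (case x of (p, q) \<Rightarrow> (norm u / fst R) ^ p * (norm v / snd R) ^ q)" for x
  proof -
    obtain p q where x: "x = (p, q)" by (cases x)
    have "monomial_size F z R p q \<le> M"
      using M
      by (intro monomial_size_Cauchy_inequality[OF F S R]) (auto simp: torus2_def cpolydisc_def)
    then have "monomial_size F z R p q * ((norm u / fst R) ^ p * (norm v / snd R) ^ q)
        \<le> M * ((norm u / fst R) ^ p * (norm v / snd R) ^ q)"
      using R by (intro mult_right_mono) auto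
    then show ?thesis
      using R by (simp add: x monomial_size_def norm_mult norm_power power_divide)
  qed
  ultimately have "(\<lambda>x. norm (case x of (p, q) \<Rightarrow> tcoeff F z p q * u ^ p * v ^ q)) summable_on UNIV"
    by (rule summable_on_comparison_test) auto
  then show ?thesis by (rule abs_summable_summable)
qed

lemma Taylor_monomials_has_sum:
  assumes F: "analytic2 F S" and S: "open S" "cpolydisc z R \<subseteq> S"
    and u: "norm u < fst R" and v: "norm v < snd R"
  shows "((\<lambda>(p, q). tcoeff F z p q * u ^ p * v ^ q) has_sum F (z + (u, v))) UNIV"
proof -
  let ?c = "snd_Taylor_coeff F (snd z)"
  have R: "0 < fst R" "0 < snd R"
    using u v norm_ge_zero[of u] norm_ge_zero[of v] by linarith+
  have "((\<lambda>(q, p). tcoeff F z p q * u ^ p * v ^ q) has_sum F (z + (u, v))) (UNIV \<times> UNIV)"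
  proof (rule has_sum_SigmaI)
    have "z \<in> S" using S(2) R by (auto simp: cpolydisc_def)
    have "?c q holomorphic_on ball (fst z) (fst R)" for q
      using S(2) R
      by (intro holomorphic_on_snd_Taylor_coeff[OF F S(1)]) (auto simp: cpolydisc_eq_Times)
    then have "((\<lambda>p. tcoeff F z p q * u ^ p * v ^ q) has_sum (?c q (fst z + u) * v ^ q)) UNIV" for q
      unfolding tcoeff_eq_deriv_snd_Taylor_coeff[OF F S(1) \<open>z \<in> S\<close>]
      using u by (intro has_sum_cmult_left holomorphic_Taylor_has_sum)
    then show "((\<lambda>p. case (q, p) of (q, p) \<Rightarrow> tcoeff F z p q * u ^ p * v ^ q) has_sum
        (?c q (fst z + u) * v ^ q)) UNIV" for q
      by simp
    have "(\<lambda>y. F (fst z + u, y)) holomorphic_on ball (snd z) (snd R)"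
      using S(2) u by (intro analytic2_holomorphic_snd[OF F])
        (auto simp: cpolydisc_def dist_norm norm_minus_commute)
    from holomorphic_Taylor_has_sum[OF this v]
    show "((\<lambda>q. ?c q (fst z + u) * v ^ q) has_sum F (z + (u, v))) UNIV"
      by (simp add: snd_Taylor_coeff_def plus_prod_def)
    show "(\<lambda>(q, p). tcoeff F z p q * u ^ p * v ^ q) summable_on UNIV \<times> UNIV"
      using Taylor_monomials_summable_on[OF F S u v]
        summable_on_swap[of "\<lambda>(p, q). tcoeff F z p q * u ^ p * v ^ q" UNIV UNIV] by simp
  qed
  then show ?thesis
    by (subst (asm) has_sum_swap) simp
qed

lemma has_sum_imp_sums_diagonals:
  fixes f :: "nat \<times> nat \<Rightarrow> 'a :: {topological_comm_monoid_add, t3_space}"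
  assumes "(f has_sum s) UNIV"
  shows "(\<lambda>k. \<Sum>j\<le>k. f (j, k - j)) sums s"
proof -
  let ?D = "Sigma (UNIV :: nat set) (\<lambda>k. {..k})"
  have "bij_betw (\<lambda>(k, j). (j, k - j)) ?D (UNIV :: (nat \<times> nat) set)"
    by (rule bij_betwI[where g = "\<lambda>(p, q). (p + q, p)"]) auto
  then have "((\<lambda>(k, j). f (j, k - j)) has_sum s) ?D"
    using assms has_sum_reindex_bij_betw[of "\<lambda>(k, j). (j, k - j)" ?D UNIV f s]
    by (simp add: case_prod_unfold)
  then have "((\<lambda>k. \<Sum>j\<le>k. f (j, k - j)) has_sum s) UNIV"
    by (rule has_sum_SigmaD) (auto intro: has_sum_finite)
  then show ?thesis by (rule has_sum_imp_sums)
qed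

lemma diag_poly_sums:
  assumes "analytic2 F S" "open S" "cpolydisc z R \<subseteq> S"
    and "norm (fst w) < fst R" "norm (snd w) < snd R"
  shows "(\<lambda>k. diag_poly F z k w) sums F (z + w)"
  using has_sum_imp_sums_diagonals[OF Taylor_monomials_has_sum[OF assms]]
  by (simp add: diag_poly_def)

section \<open>Homogeneous parts of the expansion\<close>

definition diag_max ::
    "(complex \<times> complex \<Rightarrow> complex) \<Rightarrow> complex \<times> complex \<Rightarrow> real \<times> real \<Rightarrow> nat \<Rightarrow> real" where
  "diag_max F z R k = Max ((\<lambda>j. monomial_size F z R j (k - j)) ` {..k})"

lemma monomial_size_nonneg: "0 \<le> fst R \<Longrightarrow> 0 \<le> snd R \<Longrightarrow> 0 \<le> monomial_size F z R p q"
  by (simp add: monomial_size_def)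

lemma monomial_size_mono:
  "0 \<le> fst R \<Longrightarrow> 0 \<le> snd R \<Longrightarrow> fst R \<le> fst R' \<Longrightarrow> snd R \<le> snd R' \<Longrightarrow>
    monomial_size F z R p q \<le> monomial_size F z R' p q"
  unfolding monomial_size_def by (intro mult_mono power_mono) auto

lemma monomial_size_scaleR: "monomial_size F z (r *\<^sub>R R) p q = r ^ (p + q) * monomial_size F z R p q"
  by (simp add: monomial_size_def power_mult_distrib power_add)

lemma diag_max_le_iff: "diag_max F z R k \<le> B \<longleftrightarrow> (\<forall>p q. p + q = k \<longrightarrow> monomial_size F z R p q \<le> B)"
proof -
  have "diag_max F z R k \<le> B \<longleftrightarrow> (\<forall>j\<le>k. monomial_size F z R j (k - j) \<le> B)"
    unfolding diag_max_def by (subst Max_le_iff) auto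
  then show ?thesis
    by (metis add_diff_cancel_left' le_add1 le_add_diff_inverse)
qed

lemma monomial_size_le_diag_max: "monomial_size F z R p q \<le> diag_max F z R (p + q)"
  using diag_max_le_iff by blast

lemma diag_max_nonneg: "0 \<le> fst R \<Longrightarrow> 0 \<le> snd R \<Longrightarrow> 0 \<le> diag_max F z R k"
  using monomial_size_nonneg monomial_size_le_diag_max[of F z R 0 k] by (metis add_0 order_trans)

lemma diag_max_mono:
  "0 \<le> fst R \<Longrightarrow> 0 \<le> snd R \<Longrightarrow> fst R \<le> fst R' \<Longrightarrow> snd R \<le> snd R' \<Longrightarrow>
    diag_max F z R k \<le> diag_max F z R' k"
  by (auto simp: diag_max_le_iff intro: order_trans[OF monomial_size_mono monomial_size_le_diag_max])

lemma diag_max_scaleR: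
  assumes "0 \<le> r"
  shows "diag_max F z (r *\<^sub>R R) k = r ^ k * diag_max F z R k"
proof -
  have "(\<lambda>j. monomial_size F z (r *\<^sub>R R) j (k - j)) ` {..k}
      = (\<lambda>x. r ^ k * x) ` (\<lambda>j. monomial_size F z R j (k - j)) ` {..k}"
    by (simp add: image_image monomial_size_scaleR)
  moreover have "mono (\<lambda>x. r ^ k * x)"
    using assms by (intro monoI mult_left_mono) auto
  ultimately show ?thesis
    unfolding diag_max_def by (simp add: mono_Max_commute)
qed

lemma diag_poly_scale: "diag_poly F z k (t * fst w, t * snd w) = t ^ k * diag_poly F z k w"
proof -
  have "t ^ j * t ^ (k - j) = t ^ k" if "j \<le> k" for j
    using that by (simp flip: power_add)
  then show ?thesis
    by (auto simp: diag_poly_def sum_distrib_left power_mult_distrib intro!: sum.cong)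
qed

lemma norm_diag_poly_le:
  assumes "norm (fst w) \<le> fst R" "norm (snd w) \<le> snd R"
  shows "norm (diag_poly F z k w) \<le> real (Suc k) * diag_max F z R k"
proof -
  have R: "0 \<le> fst R" "0 \<le> snd R"
    using assms norm_ge_zero order_trans by blast+
  have "norm (tcoeff F z j (k - j) * fst w ^ j * snd w ^ (k - j)) \<le> diag_max F z R k"
    if "j \<le> k" for j
  proof -
    have "norm (tcoeff F z j (k - j) * fst w ^ j * snd w ^ (k - j)) \<le> monomial_size F z R j (k - j)"
      unfolding monomial_size_def norm_mult norm_power
      using assms R by (intro mult_mono power_mono) auto
    also have "\<dots> \<le> diag_max F z R k"
      using monomial_size_le_diag_max[of F z R j "k - j"] that by simp
    finally show ?thesis .
  qed
  then have "norm (diag_poly F z k w) \<le> (\<Sum>j\<le>k. diag_max F z R k)"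
    unfolding diag_poly_def by (intro sum_norm_le) auto
  then show ?thesis by simp
qed

lemma diag_max_le_norm_diag_poly:
  assumes R: "0 < fst R" "0 < snd R"
    and le: "\<And>w. norm (fst w) = fst R \<Longrightarrow> norm (snd w) = snd R \<Longrightarrow> norm (diag_poly F z k w) \<le> B"
  shows "diag_max F z R k \<le> B"
  unfolding diag_max_le_iff
proof (intro allI impI)
  fix p q assume pq: "p + q = k"
  define P where "P = (\<Sum>j\<le>k. monom (tcoeff F z j (k - j) * of_real (snd R) ^ (k - j)) j)"
  have "poly P u = diag_poly F z k (u, of_real (snd R))" for u
    by (simp add: P_def diag_poly_def poly_sum poly_monom mult_ac)
  then have "norm (fps_nth (fps_of_poly P) p) * fst R ^ p \<le> B"
    using R le by (intro eval_fps_Cauchy_inequality) auto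
  moreover have "coeff P p = tcoeff F z p q * of_real (snd R) ^ q"
    using pq by (auto simp: P_def coeff_sum coeff_monom if_distrib sum.delta)
  ultimately show "monomial_size F z R p q \<le> B"
    using R by (simp add: monomial_size_def norm_mult norm_power mult_ac)
qed

lemma norm_le_of_diag_max_le:
  assumes F: "analytic2 F S" "open S" "cpolydisc z R \<subseteq> S" and R: "0 < fst R" "0 < snd R"
    and T: "\<And>k. diag_max F z R k \<le> T" and \<theta>: "0 \<le> \<theta>" "\<theta> < 1"
    and w: "norm (fst w) \<le> \<theta> * fst R" "norm (snd w) \<le> \<theta> * snd R"
  shows "norm (F (z + w)) \<le> T / (1 - \<theta>)\<^sup>2"
proof -
  have "\<theta> * fst R < fst R" "\<theta> * snd R < snd R"
    using \<theta> R by auto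
  then have sums: "(\<lambda>k. diag_poly F z k w) sums F (z + w)"
    using w by (intro diag_poly_sums[OF F]) linarith+
  have geometric: "(\<lambda>k. T * (of_nat (Suc k) * \<theta> ^ k)) sums (T * (1 / (1 - \<theta>)\<^sup>2))"
    using \<theta> by (intro sums_mult geometric_deriv_sums) auto
  have "norm (diag_poly F z k w) \<le> T * (of_nat (Suc k) * \<theta> ^ k)" for k
  proof -
    have "norm (diag_poly F z k w) \<le> real (Suc k) * diag_max F z (\<theta> *\<^sub>R R) k"
      using w by (intro norm_diag_poly_le) auto
    also have "\<dots> = real (Suc k) * (\<theta> ^ k * diag_max F z R k)"
      by (simp only: diag_max_scaleR[OF \<theta>(1)])
    also have "\<dots> \<le> real (Suc k) * (\<theta> ^ k * T)"
      using \<theta> by (intro mult_left_mono T) auto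
    finally show ?thesis by (simp only: mult_ac)
  qed
  then have "norm (\<Sum>k. diag_poly F z k w) \<le> (\<Sum>k. T * (of_nat (Suc k) * \<theta> ^ k))"
    using geometric by (intro norm_suminf_le) (auto simp only: sums_iff)
  then show ?thesis
    using sums geometric by (simp add: sums_iff)
qed

section \<open>Main polynomials\<close>

lemma main_polynomial_iff:
  "main_polynomial F z R k0 \<longleftrightarrow> (\<forall>w. norm (fst w) = fst R \<longrightarrow> norm (snd w) = snd R \<longrightarrow>
    norm (\<Sum>k. if k = k0 then 0 else diag_poly F z k w) \<le> diag_max F z R k0 / 2)"
  (is "?L = ?R")
proof
  assume ?L
  show ?R
  proof (intro allI impI)
    fix w :: "complex \<times> complex" assume "norm (fst w) = fst R" "norm (snd w) = snd R"
    then have "z + w \<in> torus2 z R" by (simp add: torus2_def)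
    with \<open>?L\<close> show "norm (\<Sum>k. if k = k0 then 0 else diag_poly F z k w) \<le> diag_max F z R k0 / 2"
      by (fastforce simp: main_polynomial_def diag_max_def monomial_size_def cong: if_cong)
  qed
next
  assume ?R
  then show ?L
    by (simp add: main_polynomial_def diag_max_def monomial_size_def torus2_def cong: if_cong)
qed

lemma conv_radius_diag_poly_gt_1:
  assumes F: "analytic2 F S" "open S" and \<tau>: "cpolydisc z (\<tau> *\<^sub>R R) \<subseteq> S" "1 < \<tau>"
    and R: "0 < fst R" "0 < snd R" and w: "norm (fst w) \<le> fst R" "norm (snd w) \<le> snd R"
  shows "1 < conv_radius (\<lambda>k. diag_poly F z k w)"
proof -
  obtain t where t: "1 < t" "t < \<tau>"
    using dense[OF \<open>1 < \<tau>\<close>] by blast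
  then have "t * norm (fst w) < \<tau> * fst R" "t * norm (snd w) < \<tau> * snd R"
    using w R by (auto intro: le_less_trans[OF mult_left_mono mult_strict_right_mono])
  then have "(\<lambda>k. diag_poly F z k (of_real t * fst w, of_real t * snd w)) sums
      F (z + (of_real t * fst w, of_real t * snd w))"
    using t by (intro diag_poly_sums[OF F \<tau>(1)]) (auto simp: norm_mult)
  then have "summable (\<lambda>k. diag_poly F z k w * of_real t ^ k)"
    unfolding diag_poly_scale by (simp add: sums_iff mult.commute)
  then have "norm (of_real t :: complex) \<le> conv_radius (\<lambda>k. diag_poly F z k w)"
    by (rule conv_radius_geI)
  then show ?thesis
    using t(1) by (auto simp: one_ereal_def intro: less_le_trans[of _ "ereal t"])
qed

text \<open>Along the complex line through \<open>w\<close> the remainder is a power series in one variable,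
  bounded on the unit circle; its coefficients are the remaining homogeneous polynomials at \<open>w\<close>.\<close>
lemma main_polynomial_diag_max_le:
  assumes F: "analytic2 F S" "open S" and \<tau>: "cpolydisc z (\<tau> *\<^sub>R R) \<subseteq> S" "1 < \<tau>"
    and R: "0 < fst R" "0 < snd R" and main: "main_polynomial F z R k0"
  shows "diag_max F z R k \<le> diag_max F z R k0"
proof (cases "k = k0")
  case False
  have "diag_max F z R k \<le> diag_max F z R k0 / 2"
  proof (rule diag_max_le_norm_diag_poly[OF R])
    fix w :: "complex \<times> complex" assume w: "norm (fst w) = fst R" "norm (snd w) = snd R"
    let ?f = "Abs_fps (\<lambda>k. if k = k0 then 0 else diag_poly F z k w)"
    have "conv_radius (\<lambda>k. diag_poly F z k w) = fps_conv_radius ?f"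
      unfolding fps_conv_radius_def
      by (intro conv_radius_cong' eventually_mono[OF eventually_gt_at_top[of k0]]) auto
    then have "ereal 1 < fps_conv_radius ?f"
      using conv_radius_diag_poly_gt_1[OF F \<tau> R, of w] w by (simp add: one_ereal_def)
    moreover have "norm (eval_fps ?f u) \<le> diag_max F z R k0 / 2" if "norm u = 1" for u
    proof -
      have "eval_fps ?f u = (\<Sum>k. if k = k0 then 0 else diag_poly F z k (u * fst w, u * snd w))"
        by (auto simp: eval_fps_def diag_poly_scale mult.commute intro!: suminf_cong)
      then show ?thesis
        using main w that by (simp add: main_polynomial_iff norm_mult)
    qed
    ultimately have "norm (fps_nth ?f k) * 1 ^ k \<le> diag_max F z R k0 / 2"
      by (intro eval_fps_Cauchy_inequality) auto
    then show "norm (diag_poly F z k w) \<le> diag_max F z R k0 / 2"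
      using False by simp
  qed
  also have "\<dots> \<le> diag_max F z R k0"
    using diag_max_nonneg[of R F z k0] R by simp
  finally show ?thesis .
qed simp

definition absdiff :: "nat \<Rightarrow> nat \<Rightarrow> nat" where
  "absdiff m n = (m - n) + (n - m)"

lemma Suc_le_power2_absdiff: "Suc k \<le> Suc m * 2 ^ absdiff k m"
proof -
  have "Suc k \<le> Suc m + absdiff k m"
    by (simp add: absdiff_def)
  also have "\<dots> \<le> Suc m * Suc (absdiff k m)"
    by simp
  also have "\<dots> \<le> Suc m * 2 ^ absdiff k m"
    by (intro mult_le_mono2) (simp add: Suc_leI)
  finally show ?thesis .
qed

lemma two_sided_geometric_sum:
  fixes x :: real
  assumes x: "0 \<le> x" "x < 1"
  shows "summable (\<lambda>k. if k = m then 0 else x ^ absdiff k m)" (is "summable ?g")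
    and "(\<Sum>k. if k = m then 0 else x ^ absdiff k m) \<le> 2 * (x / (1 - x))"
proof -
  have geometric: "(\<lambda>i. x * x ^ i) sums (x / (1 - x))"
    using x sums_mult[OF geometric_sums, of x x] by simp
  moreover have "?g (Suc i + m) = x * x ^ i" for i
    by (simp add: absdiff_def)
  ultimately have "(\<lambda>i. ?g (Suc i + m)) sums (x / (1 - x))" by simp
  then have "(\<lambda>i. ?g (i + m)) sums (x / (1 - x))"
    using sums_Suc_iff[of "\<lambda>i. ?g (i + m)"] by simp
  then have g: "?g sums (x / (1 - x) + (\<Sum>i<m. ?g i))"
    by (subst (asm) sums_iff_shift)
  have "(\<Sum>i<m. ?g i) = (\<Sum>i<m. x * x ^ (m - Suc i))"
    by (rule sum.cong) (auto simp: absdiff_def Suc_diff_Suc simp flip: power_Suc)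
  also have "\<dots> = (\<Sum>i<m. x * x ^ i)"
    by (rule sum.nat_diff_reindex)
  also have "\<dots> \<le> (\<Sum>i. x * x ^ i)"
    using geometric x by (intro sum_le_suminf) (auto simp: sums_iff)
  finally have "(\<Sum>i<m. ?g i) \<le> x / (1 - x)"
    using geometric by (simp add: sums_iff)
  with g show "summable ?g" "(\<Sum>k. if k = m then 0 else x ^ absdiff k m) \<le> 2 * (x / (1 - x))"
    by (auto simp: sums_iff)
qed

lemma two_sided_geometric_sum_le_half:
  assumes x: "0 \<le> x" "x \<le> 1 / (8 * (real m + 1))"
  shows "summable (\<lambda>k. if k = m then 0 else x ^ absdiff k m)" (is "summable ?g")
    and "(real m + 1) * (\<Sum>k. if k = m then 0 else x ^ absdiff k m) \<le> 1 / 2"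
proof -
  have x8: "(real m + 1) * x \<le> 1 / 8"
    using x(2) by (simp add: field_simps)
  moreover have "1 * x \<le> (real m + 1) * x"
    using x(1) by (intro mult_right_mono) auto
  ultimately have "x \<le> 1 / 8" by linarith
  then have "x < 1" "1 \<le> 2 * (1 - x)" by simp_all
  show "summable ?g"
    using x(1) \<open>x < 1\<close> by (rule two_sided_geometric_sum)
  have "x * 1 \<le> x * (2 * (1 - x))"
    using x(1) \<open>1 \<le> 2 * (1 - x)\<close> by (intro mult_left_mono)
  then have "x / (1 - x) \<le> 2 * x"
    using \<open>x < 1\<close> by (simp add: pos_divide_le_eq mult_ac)
  then have "suminf ?g \<le> 4 * x"
    using two_sided_geometric_sum(2)[OF x(1) \<open>x < 1\<close>, of m] by linarith
  then have "(real m + 1) * suminf ?g \<le> (real m + 1) * (4 * x)"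
    by (intro mult_left_mono) auto
  also have "\<dots> \<le> 1 / 2" using x8 by simp
  finally show "(real m + 1) * suminf ?g \<le> 1 / 2" .
qed

lemma norm_diag_poly_le_geometric:
  assumes w: "norm (fst w) \<le> fst R" "norm (snd w) \<le> snd R" and "0 \<le> s" "0 \<le> T"
    and le: "diag_max F z R k \<le> T * s ^ absdiff k m"
  shows "norm (diag_poly F z k w) \<le> T * (real m + 1) * (2 * s) ^ absdiff k m"
proof -
  have "norm (diag_poly F z k w) \<le> real (Suc k) * (T * s ^ absdiff k m)"
    using le by (intro order_trans[OF norm_diag_poly_le[OF w]] mult_left_mono) auto
  also have "real (Suc k) \<le> real (Suc m * 2 ^ absdiff k m)"
    unfolding of_nat_le_iff by (rule Suc_le_power2_absdiff)
  then have "real (Suc k) * (T * s ^ absdiff k m)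
      \<le> real (Suc m * 2 ^ absdiff k m) * (T * s ^ absdiff k m)"
    using \<open>0 \<le> s\<close> \<open>0 \<le> T\<close> by (intro mult_right_mono) auto
  finally show ?thesis
    by (simp add: power_mult_distrib mult_ac add.commute del: mult_Suc)
qed

lemma main_polynomialI_geometric:
  assumes R: "0 \<le> fst R" "0 \<le> snd R" and s: "0 \<le> s" "s \<le> 1 / (16 * (real k0 + 1))"
    and decay: "\<And>k. diag_max F z R k \<le> diag_max F z R k0 * s ^ absdiff k k0"
  shows "main_polynomial F z R k0"
  unfolding main_polynomial_iff
proof (intro allI impI)
  fix w :: "complex \<times> complex" assume w: "norm (fst w) = fst R" "norm (snd w) = snd R"
  let ?T = "diag_max F z R k0" and ?g = "\<lambda>k. if k = k0 then 0 else (2 * s) ^ absdiff k k0"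
  have T: "0 \<le> ?T" using R by (rule diag_max_nonneg)
  have "0 \<le> 2 * s" "2 * s \<le> 1 / (8 * (real k0 + 1))"
    using s by (auto simp: field_simps)
  note g = two_sided_geometric_sum_le_half[OF this]
  have "norm (if k = k0 then 0 else diag_poly F z k w) \<le> ?T * (real k0 + 1) * ?g k" for k
    using norm_diag_poly_le_geometric[OF _ _ s(1) T decay[of k], of w] w by simp
  then have "norm (\<Sum>k. if k = k0 then 0 else diag_poly F z k w) \<le> (\<Sum>k. ?T * (real k0 + 1) * ?g k)"
    using g(1) by (intro norm_suminf_le summable_mult)
  also have "\<dots> = ?T * ((real k0 + 1) * suminf ?g)"
    using suminf_mult[OF g(1)] by simp
  also have "\<dots> \<le> ?T * (1 / 2)"
    using g(2) T by (rule mult_left_mono)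
  finally show "norm (\<Sum>k. if k = k0 then 0 else diag_poly F z k w) \<le> ?T / 2" by simp
qed

section \<open>Dominant terms at geometrically spaced radii\<close>

lemma dominant_index_exists:
  fixes A :: "nat \<Rightarrow> real"
  assumes dom: "\<And>k. \<exists>m\<le>n. A k \<le> A m" and A: "\<And>k. 0 \<le> A k" and x: "0 \<le> x" "x \<le> 1"
  shows "\<exists>m\<le>n. \<forall>k. A k * x ^ k \<le> A m * x ^ m"
proof -
  let ?I = "(\<lambda>k. A k * x ^ k) ` {..n}"
  have "Max ?I \<in> ?I" by (rule Max_in) auto
  then obtain m where m: "m \<le> n" "Max ?I = A m * x ^ m" by blast
  have max: "A k * x ^ k \<le> A m * x ^ m" if "k \<le> n" for k
    using that by (auto simp flip: m(2))
  have "A k * x ^ k \<le> A m * x ^ m" if "n < k" for k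
  proof -
    obtain i where i: "i \<le> n" "A k \<le> A i" using dom by blast
    have "A k * x ^ k \<le> A i * x ^ i"
      using i that A x by (intro mult_mono power_decreasing) auto
    also have "\<dots> \<le> A m * x ^ m" using i(1) by (rule max)
    finally show ?thesis .
  qed
  with max m(1) show ?thesis by (meson not_le)
qed

lemma geometric_decay_between_radii:
  fixes A :: "nat \<Rightarrow> real"
  assumes A: "0 \<le> A m" and s: "0 \<le> s" and "0 < r" "0 < \<sigma>"
    and outer: "r = \<rho> * s" "A k * \<rho> ^ k \<le> A m * \<rho> ^ m"
    and inner: "\<sigma> \<le> r * s" "A k * \<sigma> ^ k \<le> A m * \<sigma> ^ m"
  shows "A k * r ^ k \<le> A m * r ^ m * s ^ absdiff k m"
proof (cases "m \<le> k")
  case True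
  have "A k * r ^ k = A k * \<rho> ^ k * s ^ k"
    by (simp add: outer(1) power_mult_distrib)
  also have "\<dots> \<le> A m * \<rho> ^ m * s ^ k"
    using s outer(2) by (intro mult_right_mono) auto
  also have "s ^ k = s ^ m * s ^ (k - m)"
    using True by (simp flip: power_add)
  also have "A m * \<rho> ^ m * (s ^ m * s ^ (k - m)) = A m * r ^ m * s ^ absdiff k m"
    using True by (simp add: outer(1) power_mult_distrib absdiff_def)
  finally show ?thesis .
next
  case False
  have "A k * r ^ k = A k * \<sigma> ^ k * (r / \<sigma>) ^ k"
    using \<open>0 < \<sigma>\<close> by (simp add: power_divide)
  also have "\<dots> \<le> A m * \<sigma> ^ m * (r / \<sigma>) ^ k"
    using inner(2) \<open>0 < r\<close> \<open>0 < \<sigma>\<close> by (intro mult_right_mono) auto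
  also have "\<dots> = A m * r ^ k * \<sigma> ^ (m - k)"
    using False \<open>0 < \<sigma>\<close> by (simp add: power_divide power_diff)
  also have "\<dots> \<le> A m * r ^ k * (r * s) ^ (m - k)"
    using A inner(1) \<open>0 < r\<close> \<open>0 < \<sigma>\<close> by (intro mult_left_mono power_mono) auto
  also have "\<dots> = A m * (r ^ k * r ^ (m - k)) * s ^ (m - k)"
    by (simp add: power_mult_distrib)
  also have "r ^ k * r ^ (m - k) = r ^ m"
    using False by (simp flip: power_add)
  finally show ?thesis
    using False by (simp add: absdiff_def)
qed

text \<open>Among the \<open>n + 2\<close> radii \<open>\<delta> s ^ (2 * i)\<close> two share their dominant index, and the
  radius \<open>s\<close> times the larger of the two is separated from both by a factor of at least \<open>s\<close>.\<close>
lemma geometrically_dominant_radius: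
  fixes A :: "nat \<Rightarrow> real"
  assumes dom: "\<And>k. \<exists>m\<le>n. A k \<le> A m" and A: "\<And>k. 0 \<le> A k"
    and \<delta>: "0 < \<delta>" "\<delta> \<le> 1" and s: "0 < s" "s < 1"
  obtains r m where "\<delta> * s ^ (2 * n + 2) < r" "r \<le> \<delta>" "m \<le> n"
    "\<And>k. A k * r ^ k \<le> A m * r ^ m * s ^ absdiff k m"
proof -
  define \<rho> where "\<rho> i = \<delta> * s ^ (2 * i)" for i
  have "\<exists>m\<le>n. \<forall>k. A k * \<rho> i ^ k \<le> A m * \<rho> i ^ m" for i
    using \<delta> s by (intro dominant_index_exists dom A) (auto simp: \<rho>_def mult_le_one power_le_one)
  then obtain \<nu> where \<nu>: "\<And>i. \<nu> i \<le> n" "\<And>i k. A k * \<rho> i ^ k \<le> A (\<nu> i) * \<rho> i ^ \<nu> i"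
    by metis
  have "card (\<nu> ` {..n + 1}) \<le> card {..n}"
    using \<nu>(1) by (intro card_mono) auto
  then have "\<not> inj_on \<nu> {..n + 1}"
    by (intro pigeonhole) simp
  then obtain i j where ij: "i < j" "j \<le> n + 1" "\<nu> i = \<nu> j"
    by (metis atMost_iff inj_onI linorder_neqE_nat)
  define r where "r = \<rho> i * s"
  have r_eq: "r = \<delta> * s ^ (2 * i + 1)" by (simp add: r_def \<rho>_def)
  show ?thesis
  proof
    show "\<delta> * s ^ (2 * n + 2) < r"
      unfolding r_eq using \<delta> s ij by (intro mult_strict_left_mono power_strict_decreasing) auto
    show "r \<le> \<delta>"
      unfolding r_eq using \<delta> s by (intro mult_left_le power_le_one) auto
    show "\<nu> i \<le> n" by (rule \<nu>(1))
    show "A k * r ^ k \<le> A (\<nu> i) * r ^ \<nu> i * s ^ absdiff k (\<nu> i)" for k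
    proof (rule geometric_decay_between_radii[where \<rho> = "\<rho> i" and \<sigma> = "\<rho> j"])
      have "\<rho> j \<le> \<delta> * s ^ (2 * i + 2)"
        unfolding \<rho>_def using \<delta> s ij(1) by (intro mult_left_mono power_decreasing) auto
      then show "\<rho> j \<le> r * s" by (simp add: r_eq mult_ac)
      show "A k * \<rho> j ^ k \<le> A (\<nu> i) * \<rho> j ^ \<nu> i"
        unfolding ij(3) by (rule \<nu>(2))
    qed (use A \<nu>(2) \<delta> s in \<open>auto simp: r_def \<rho>_def\<close>)
  qed
qed

lemma main_polynomial_exists:
  assumes R: "0 \<le> fst R" "0 \<le> snd R" and dom: "\<And>k. \<exists>m\<le>n. diag_max F z R k \<le> diag_max F z R m"
    and \<delta>: "0 < \<delta>" "\<delta> \<le> 1" and s: "0 < s" "s \<le> 1 / (16 * (real n + 1))"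
  obtains r k0 where "\<delta> * s ^ (2 * n + 2) < r" "r \<le> \<delta>" "k0 \<le> n" "main_polynomial F z (r *\<^sub>R R) k0"
proof -
  have "1 / (16 * (real n + 1)) < 1" by simp
  then have "s < 1" using s(2) by linarith
  obtain r k0 where r: "\<delta> * s ^ (2 * n + 2) < r" "r \<le> \<delta>" "k0 \<le> n"
    and decay: "\<And>k. diag_max F z R k * r ^ k \<le> diag_max F z R k0 * r ^ k0 * s ^ absdiff k k0"
    using geometrically_dominant_radius[of n "diag_max F z R" \<delta> s] dom diag_max_nonneg[OF R]
      \<delta> s(1) \<open>s < 1\<close> by metis
  have "0 < \<delta> * s ^ (2 * n + 2)" using \<delta> s by simp
  then have "0 \<le> r" using r(1) by linarith
  have "main_polynomial F z (r *\<^sub>R R) k0"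
  proof (rule main_polynomialI_geometric)
    have "1 / (16 * (real n + 1)) \<le> 1 / (16 * (real k0 + 1))"
      using r(3) by (auto intro!: divide_left_mono)
    with s(2) show "s \<le> 1 / (16 * (real k0 + 1))" by linarith
    show "diag_max F z (r *\<^sub>R R) k \<le> diag_max F z (r *\<^sub>R R) k0 * s ^ absdiff k k0" for k
      using decay[of k] by (simp add: diag_max_scaleR[OF \<open>0 \<le> r\<close>] mult_ac)
  qed (use R \<open>0 \<le> r\<close> s in auto)
  with r that show ?thesis by blast
qed

section \<open>Jets and the index\<close>

definition jet_max ::
    "(complex \<times> complex \<Rightarrow> complex) \<Rightarrow> complex \<times> complex \<Rightarrow> real \<times> real \<Rightarrow> nat \<Rightarrow> real" where
  "jet_max F z R n = Max (diag_max F z R ` {..n})"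

lemma jet_max_le_iff: "jet_max F z R n \<le> B \<longleftrightarrow> (\<forall>k\<le>n. diag_max F z R k \<le> B)"
  unfolding jet_max_def by (subst Max_le_iff) auto

lemma diag_max_le_jet_max: "k \<le> n \<Longrightarrow> diag_max F z R k \<le> jet_max F z R n"
  using jet_max_le_iff by blast

lemma jet_max_attained: "\<exists>m\<le>n. jet_max F z R n = diag_max F z R m"
proof -
  have "jet_max F z R n \<in> diag_max F z R ` {..n}"
    unfolding jet_max_def by (rule Max_in) auto
  then show ?thesis by blast
qed

lemma jet_max_eq_Max_monomial_size:
  "jet_max F z R n = Max ((\<lambda>(p, q). monomial_size F z R p q) ` {(p, q). p + q \<le> n})"
proof (rule Max_eqI[symmetric])
  show "finite ((\<lambda>(p, q). monomial_size F z R p q) ` {(p, q). p + q \<le> n})"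
    by (rule finite_imageI, rule finite_subset[of _ "{..n} \<times> {..n}"]) auto
next
  fix x assume "x \<in> (\<lambda>(p, q). monomial_size F z R p q) ` {(p, q). p + q \<le> n}"
  then show "x \<le> jet_max F z R n"
    by (auto intro: order_trans[OF monomial_size_le_diag_max diag_max_le_jet_max])
next
  obtain m where m: "m \<le> n" "jet_max F z R n = diag_max F z R m"
    using jet_max_attained by blast
  have "diag_max F z R m \<in> (\<lambda>j. monomial_size F z R j (m - j)) ` {..m}"
    unfolding diag_max_def by (rule Max_in) auto
  then obtain j where "j \<le> m" "diag_max F z R m = monomial_size F z R j (m - j)"
    by auto
  with m show "jet_max F z R n \<in> (\<lambda>(p, q). monomial_size F z R p q) ` {(p, q). p + q \<le> n}"
    by (intro image_eqI[of _ _ "(j, m - j)"]) auto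
qed

lemma norm_le_jet_max: "norm (F z) \<le> jet_max F z R n"
proof -
  have "norm (F z) = monomial_size F z R 0 0"
    by (simp add: monomial_size_def tcoeff_def pderiv2_def)
  also have "\<dots> \<le> diag_max F z R 0"
    using monomial_size_le_diag_max[of F z R 0 0] by simp
  also have "\<dots> \<le> jet_max F z R n" by (rule diag_max_le_jet_max) simp
  finally show ?thesis .
qed

lemma jet_max_mono_order: "m \<le> n \<Longrightarrow> jet_max F z R m \<le> jet_max F z R n"
  by (auto simp: jet_max_le_iff intro: diag_max_le_jet_max)

lemma jet_max_le_power_mult:
  assumes R: "0 \<le> fst R" "0 \<le> snd R" and "0 \<le> fst R'" "0 \<le> snd R'"
    and t: "1 \<le> t" and "fst R' \<le> t * fst R" "snd R' \<le> t * snd R"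
  shows "jet_max F z R' n \<le> t ^ n * jet_max F z R n"
  unfolding jet_max_le_iff
proof (intro allI impI)
  fix k assume "k \<le> n"
  have "diag_max F z R' k \<le> diag_max F z (t *\<^sub>R R) k"
    using assms by (intro diag_max_mono) auto
  also have "\<dots> = t ^ k * diag_max F z R k"
    using t by (intro diag_max_scaleR) auto
  also have "\<dots> \<le> t ^ n * jet_max F z R n"
    using R t \<open>k \<le> n\<close> by (intro mult_mono power_increasing diag_max_le_jet_max diag_max_nonneg) auto
  finally show "diag_max F z R' k \<le> t ^ n * jet_max F z R n" .
qed

definition unit_radius ::
    "(complex \<times> complex \<Rightarrow> real) \<Rightarrow> (complex \<times> complex \<Rightarrow> real) \<Rightarrow> complex \<times> complex \<Rightarrow> real \<times> real" where
  "unit_radius l1 l2 z = (1 / l1 z, 1 / l2 z)"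

lemma scaleR_unit_radius: "r *\<^sub>R unit_radius l1 l2 z = (r / l1 z, r / l2 z)"
  by (simp add: unit_radius_def)

lemma bounded_L_index_joint_iff:
  "bounded_L_index_joint F l1 l2 \<longleftrightarrow>
    (\<exists>n. \<forall>z\<in>bidisc. \<forall>k.
      diag_max F z (unit_radius l1 l2 z) k \<le> jet_max F z (unit_radius l1 l2 z) n)"
proof -
  have "norm (pderiv2 F p q z) / (fact p * fact q * l1 z ^ p * l2 z ^ q)
      = monomial_size F z (unit_radius l1 l2 z) p q" for p q z
    by (simp add: monomial_size_def unit_radius_def tcoeff_def norm_divide norm_mult
        power_one_over field_simps)
  then show ?thesis
    by (simp add: bounded_L_index_joint_def jet_max_eq_Max_monomial_size diag_max_le_iff)
qed

section \<open>Admissible weights\<close>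

lemma open_bidisc: "open bidisc"
  unfolding bidisc_def by (intro open_Collect_conj open_Collect_less continuous_intros)

locale admissible_weights =
  fixes \<beta> :: real and l1 l2 :: "complex \<times> complex \<Rightarrow> real"
  assumes \<beta>_gt_1: "1 < \<beta>"
    and l1_gt: "z \<in> bidisc \<Longrightarrow> \<beta> / (1 - norm (fst z)) < l1 z"
    and l2_gt: "z \<in> bidisc \<Longrightarrow> \<beta> / (1 - norm (snd z)) < l2 z"
begin

abbreviation U :: "complex \<times> complex \<Rightarrow> real \<times> real" where
  "U \<equiv> unit_radius l1 l2"

lemma weights_pos:
  assumes "z \<in> bidisc"
  shows "0 < l1 z" "0 < l2 z"
proof -
  have "0 < \<beta> / (1 - norm (fst z))" "0 < \<beta> / (1 - norm (snd z))"
    using assms \<beta>_gt_1 by (auto simp: bidisc_def)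
  then show "0 < l1 z" "0 < l2 z"
    using l1_gt[OF assms] l2_gt[OF assms] by linarith+
qed

lemma unit_radius_pos:
  assumes "z \<in> bidisc"
  shows "0 < fst (U z)" "0 < snd (U z)"
  using weights_pos[OF assms] by (simp_all add: unit_radius_def)

lemma cpolydisc_subset_bidisc:
  assumes z: "z \<in> bidisc" and "r \<le> \<beta>"
  shows "cpolydisc z (r *\<^sub>R U z) \<subseteq> bidisc"
proof
  fix w assume "w \<in> cpolydisc z (r *\<^sub>R U z)"
  moreover have "r / l1 z \<le> \<beta> / l1 z" "r / l2 z \<le> \<beta> / l2 z"
    using \<open>r \<le> \<beta>\<close> weights_pos[OF z] by (auto intro: divide_right_mono)
  moreover have "\<beta> / l1 z < 1 - norm (fst z)" "\<beta> / l2 z < 1 - norm (snd z)"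
    using l1_gt[OF z] l2_gt[OF z] weights_pos[OF z] z by (auto simp: bidisc_def field_simps)
  ultimately show "w \<in> bidisc"
    using norm_triangle_sub[of "fst w" "fst z"] norm_triangle_sub[of "snd w" "snd z"]
    by (simp add: cpolydisc_def bidisc_def unit_radius_def)
qed

lemma bounded_index_imp_main_polynomials:
  assumes "bounded_L_index_joint F l1 l2"
  shows "\<exists>n. \<forall>d>0. \<exists>\<eta>>0. \<eta> < d \<and>
    (\<forall>z\<in>bidisc. \<exists>r k0. \<eta> < r \<and> r < d \<and> k0 \<le> n \<and> main_polynomial F z (r *\<^sub>R U z) k0)"
proof -
  obtain n where n: "\<And>z k. z \<in> bidisc \<Longrightarrow> diag_max F z (U z) k \<le> jet_max F z (U z) n"
    using assms unfolding bounded_L_index_joint_iff by blast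
  have dom: "\<exists>m\<le>n. diag_max F z (U z) k \<le> diag_max F z (U z) m" if "z \<in> bidisc" for z k
    using n[OF that, of k] jet_max_attained[of n F z "U z"] by auto
  show ?thesis
  proof (rule exI[of _ n], intro allI impI)
    fix d :: real assume "0 < d"
    define \<delta> s where "\<delta> = min d 1 / 2" and "s = 1 / (16 * (real n + 1))"
    define \<eta> where "\<eta> = \<delta> * s ^ (2 * n + 2)"
    have \<delta>: "0 < \<delta>" "\<delta> \<le> 1" "\<delta> < d" using \<open>0 < d\<close> by (auto simp: \<delta>_def)
    have s: "0 < s" "s \<le> 1" by (auto simp: s_def field_simps)
    have "\<exists>r k0. \<eta> < r \<and> r < d \<and> k0 \<le> n \<and> main_polynomial F z (r *\<^sub>R U z) k0"
      if z: "z \<in> bidisc" for z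
    proof -
      have "0 \<le> fst (U z)" "0 \<le> snd (U z)"
        using unit_radius_pos[OF z] by simp_all
      then obtain r k0 where "\<eta> < r" "r \<le> \<delta>" "k0 \<le> n" "main_polynomial F z (r *\<^sub>R U z) k0"
        unfolding \<eta>_def
        using main_polynomial_exists[OF _ _ dom[OF z] \<delta>(1,2) s(1) eq_refl[OF s_def]] by blast
      with \<delta>(3) show ?thesis by (intro exI[of _ r] exI[of _ k0]) auto
    qed
    moreover have "0 < \<eta>" using \<delta> s by (simp add: \<eta>_def)
    moreover have "\<eta> \<le> \<delta>"
      unfolding \<eta>_def using \<delta> s by (intro mult_left_le power_le_one) auto
    ultimately show "\<exists>\<eta>>0. \<eta> < d \<and>
        (\<forall>z\<in>bidisc. \<exists>r k0. \<eta> < r \<and> r < d \<and> k0 \<le> n \<and> main_polynomial F z (r *\<^sub>R U z) k0)"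
      using \<delta>(3) by (intro exI[of _ \<eta>]) auto
  qed
qed

end

locale comparable_weights = admissible_weights +
  fixes C :: real
  assumes C_ge_1: "1 \<le> C"
    and comparable: "z \<in> bidisc \<Longrightarrow> w \<in> cpolydisc z (\<beta> *\<^sub>R U z) \<Longrightarrow> l \<in> {l1, l2} \<Longrightarrow>
      l w \<le> C * l z \<and> l z \<le> C * l w"

lemma lambda1_le_quotient:
  assumes "z \<in> bidisc" "w \<in> cpolydisc z (fst R / l1 z, snd R / l2 z)"
  shows "lambda1 l l1 l2 R \<le> ereal (l w / l z)"
  unfolding lambda1_def by (intro INF_lower2[OF assms(1)] INF_lower2[OF assms(2)] order_refl)

lemma quotient_le_lambda2:
  assumes "z \<in> bidisc" "w \<in> cpolydisc z (fst R / l1 z, snd R / l2 z)"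
  shows "ereal (l w / l z) \<le> lambda2 l l1 l2 R"
  unfolding lambda2_def by (intro SUP_upper2[OF assms(1)] SUP_upper2[OF assms(2)] order_refl)

lemma (in admissible_weights) Q2_imp_comparable_weights:
  assumes Q: "Q2 \<beta> l1 l2"
  obtains C where "comparable_weights \<beta> l1 l2 C"
proof -
  have lambda: "0 < lambda1 l l1 l2 (\<beta>, \<beta>)" "lambda2 l l1 l2 (\<beta>, \<beta>) < \<infinity>" if "l \<in> {l1, l2}" for l
    using Q \<beta>_gt_1 that by (auto simp: Q2_def)
  have "0 < min (lambda1 l1 l1 l2 (\<beta>, \<beta>)) (lambda1 l2 l1 l2 (\<beta>, \<beta>))"
    "max (lambda2 l1 l1 l2 (\<beta>, \<beta>)) (lambda2 l2 l1 l2 (\<beta>, \<beta>)) < \<infinity>"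
    using lambda[of l1] lambda[of l2]
    by (simp_all only: min_less_iff_conj max_less_iff_conj simp_thms insertI1 insertI2)
  then obtain c C where "0 < ereal c"
    and "ereal c < min (lambda1 l1 l1 l2 (\<beta>, \<beta>)) (lambda1 l2 l1 l2 (\<beta>, \<beta>))"
    and "max (lambda2 l1 l1 l2 (\<beta>, \<beta>)) (lambda2 l2 l1 l2 (\<beta>, \<beta>)) < ereal C"
    by (metis ereal_dense2)
  then have c: "0 < c" "\<And>l. l \<in> {l1, l2} \<Longrightarrow> ereal c < lambda1 l l1 l2 (\<beta>, \<beta>)"
    and C: "\<And>l. l \<in> {l1, l2} \<Longrightarrow> lambda2 l l1 l2 (\<beta>, \<beta>) < ereal C"
    by auto
  let ?C = "max 1 (max C (1 / c))"
  have "comparable_weights \<beta> l1 l2 ?C"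
  proof
    fix z w l assume z: "z \<in> bidisc" and w: "w \<in> cpolydisc z (\<beta> *\<^sub>R U z)" and l: "l \<in> {l1, l2}"
    have "lambda1 l l1 l2 (\<beta>, \<beta>) \<le> ereal (l w / l z)" "ereal (l w / l z) \<le> lambda2 l l1 l2 (\<beta>, \<beta>)"
      using z w
      by (auto simp: scaleR_unit_radius intro: lambda1_le_quotient quotient_le_lambda2)
    then have "ereal c \<le> ereal (l w / l z)" "ereal (l w / l z) \<le> ereal C"
      using c(2)[OF l] C[OF l] by order+
    moreover have pos: "0 < l z" "0 < l w"
      using weights_pos[OF z] weights_pos[of w] cpolydisc_subset_bidisc[OF z order_refl] w l by auto
    ultimately have "l w \<le> C * l z" "l z \<le> 1 / c * l w"
      using c(1) by (auto simp: field_simps)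
    then show "l w \<le> ?C * l z \<and> l z \<le> ?C * l w"
      using mult_right_mono[of C ?C "l z"] mult_right_mono[of "1 / c" ?C "l w"] pos by linarith
  qed simp
  then show ?thesis by (rule that)
qed

section \<open>From main polynomials to bounded index\<close>

context comparable_weights
begin

lemma unit_radius_comparable:
  assumes z: "z \<in> bidisc" and w: "w \<in> cpolydisc z (\<beta> *\<^sub>R U z)"
  shows "fst (U w) \<le> C * fst (U z)" "snd (U w) \<le> C * snd (U z)"
    and "fst (U z) \<le> C * fst (U w)" "snd (U z) \<le> C * snd (U w)"
proof -
  have "w \<in> bidisc" using cpolydisc_subset_bidisc[OF z order_refl] w by blast
  then show "fst (U w) \<le> C * fst (U z)" "snd (U w) \<le> C * snd (U z)"
    and "fst (U z) \<le> C * fst (U w)" "snd (U z) \<le> C * snd (U w)"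
    using comparable[OF z w, of l1] comparable[OF z w, of l2] weights_pos[OF z] weights_pos[of w]
    by (simp_all add: unit_radius_def field_simps)
qed

lemma main_polynomial_imp_norm_le_jet_max:
  assumes F: "analytic2 F bidisc" and z: "z \<in> bidisc"
    and r: "0 < r" "r \<le> 1" and main: "main_polynomial F z (r *\<^sub>R U z) k0" "k0 \<le> n"
    and w: "norm (fst w) \<le> 2 / 3 * r * fst (U z)" "norm (snd w) \<le> 2 / 3 * r * snd (U z)"
  shows "norm (F (z + w)) \<le> 9 * jet_max F z (U z) n"
proof -
  note U = unit_radius_pos[OF z]
  have "diag_max F z (r *\<^sub>R U z) k \<le> jet_max F z (U z) n" for k
  proof -
    have "diag_max F z (r *\<^sub>R U z) k \<le> diag_max F z (r *\<^sub>R U z) k0"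
    proof (rule main_polynomial_diag_max_le[OF F open_bidisc _ _ _ _ main(1)])
      show "cpolydisc z ((\<beta> / r) *\<^sub>R r *\<^sub>R U z) \<subseteq> bidisc"
        using cpolydisc_subset_bidisc[OF z order_refl] r by simp
    qed (use r \<beta>_gt_1 U in auto)
    also have "\<dots> = r ^ k0 * diag_max F z (U z) k0"
      using r by (intro diag_max_scaleR) auto
    also have "\<dots> \<le> 1 * jet_max F z (U z) n"
      using r U main(2) by (intro mult_mono power_le_one diag_max_le_jet_max diag_max_nonneg) auto
    finally show ?thesis by simp
  qed
  then have "norm (F (z + w)) \<le> jet_max F z (U z) n / (1 - 2 / 3)\<^sup>2"
    using r \<beta>_gt_1 U w
    by (intro norm_le_of_diag_max_le[OF F open_bidisc cpolydisc_subset_bidisc[OF z, of r]]) auto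
  then show ?thesis by (simp add: power2_eq_square)
qed

lemma jet_max_nearby_same_radius_le:
  assumes F: "analytic2 F bidisc" and z: "z \<in> bidisc"
    and \<eta>: "0 < \<eta>" "\<eta> \<le> r" "r \<le> 1" and main: "main_polynomial F z (r *\<^sub>R U z) k0" "k0 \<le> n"
    and w: "w \<in> cpolydisc z ((\<eta> / 3) *\<^sub>R U z)"
  shows "jet_max F w ((\<eta> / 3) *\<^sub>R U z) n \<le> 9 * jet_max F z (U z) n"
proof -
  note U = unit_radius_pos[OF z]
  let ?R = "(\<eta> / 3) *\<^sub>R U z"
  have near: "y \<in> cpolydisc z ((2 / 3 * r) *\<^sub>R U z)" if "y \<in> cpolydisc w ?R" for y
  proof -
    have "2 * (\<eta> / 3 * fst (U z)) \<le> 2 / 3 * r * fst (U z)"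
      "2 * (\<eta> / 3 * snd (U z)) \<le> 2 / 3 * r * snd (U z)"
      using \<eta> U by simp_all
    then show ?thesis
      using that w norm_triangle_ineq[of "fst y - fst w" "fst w - fst z"]
        norm_triangle_ineq[of "snd y - snd w" "snd w - snd z"]
      by (simp add: cpolydisc_def)
  qed
  have "norm (F y) \<le> 9 * jet_max F z (U z) n" if "y \<in> torus2 w ?R" for y
  proof -
    have "y \<in> cpolydisc z ((2 / 3 * r) *\<^sub>R U z)"
      using that by (intro near) (simp add: torus2_def cpolydisc_def)
    then show ?thesis
      using main_polynomial_imp_norm_le_jet_max[OF F z _ \<eta>(3) main, of "y - z"] \<eta>
      by (simp add: cpolydisc_def)
  qed
  moreover have "cpolydisc w ?R \<subseteq> bidisc"
    using near cpolydisc_subset_bidisc[OF z, of "2 / 3 * r"] \<eta> \<beta>_gt_1 by auto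
  ultimately show ?thesis
    unfolding jet_max_le_iff diag_max_le_iff
    using \<eta> U by (intro allI impI monomial_size_Cauchy_inequality[OF F open_bidisc]) auto
qed

lemma jet_max_nearby_le:
  assumes F: "analytic2 F bidisc" and z: "z \<in> bidisc"
    and \<eta>: "0 < \<eta>" "\<eta> \<le> r" "r \<le> 1" and main: "main_polynomial F z (r *\<^sub>R U z) k0" "k0 \<le> n"
    and w: "w \<in> cpolydisc z ((\<eta> / 3) *\<^sub>R U z)"
  shows "jet_max F w (U w) n \<le> 9 * (3 * C / \<eta>) ^ n * jet_max F z (U z) n"
proof -
  note U = unit_radius_pos[OF z]
  let ?R = "(\<eta> / 3) *\<^sub>R U z"
  have "\<eta> / 3 * fst (U z) \<le> \<beta> * fst (U z)" "\<eta> / 3 * snd (U z) \<le> \<beta> * snd (U z)"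
    using \<eta> \<beta>_gt_1 U by (auto intro: mult_right_mono)
  then have "w \<in> cpolydisc z (\<beta> *\<^sub>R U z)"
    using w by (simp add: cpolydisc_def)
  then have "fst (U w) \<le> 3 * C / \<eta> * fst ?R" "snd (U w) \<le> 3 * C / \<eta> * snd ?R" "w \<in> bidisc"
    using unit_radius_comparable(1,2)[OF z] cpolydisc_subset_bidisc[OF z order_refl] \<eta> by auto
  moreover have "1 \<le> 3 * C / \<eta>"
    using \<eta> C_ge_1 by simp
  ultimately have "jet_max F w (U w) n \<le> (3 * C / \<eta>) ^ n * jet_max F w ?R n"
    using \<eta> U unit_radius_pos[of w] by (intro jet_max_le_power_mult) auto
  also have "\<dots> \<le> (3 * C / \<eta>) ^ n * (9 * jet_max F z (U z) n)"
    using \<eta> C_ge_1 by (intro mult_left_mono jet_max_nearby_same_radius_le[OF F z \<eta> main w]) auto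
  finally show ?thesis by (simp add: mult_ac)
qed

lemma short_segment_in_cpolydisc:
  assumes z: "z \<in> bidisc" and w: "w \<in> cpolydisc z (\<beta> *\<^sub>R U z)"
    and y: "y \<in> cpolydisc z (\<beta> *\<^sub>R U z)" and t: "0 \<le> t" "t * (\<beta> * C) \<le> \<epsilon>"
  shows "y + t *\<^sub>R (w - z) \<in> cpolydisc y (\<epsilon> *\<^sub>R U y)"
proof -
  have "y \<in> bidisc" using cpolydisc_subset_bidisc[OF z order_refl] y by blast
  have short: "t * x \<le> \<epsilon> * u'" if "x \<le> \<beta> * u" "u \<le> C * u'" "0 \<le> u'" for x u u'
  proof -
    have "x \<le> \<beta> * (C * u')"
      using that(1) mult_left_mono[OF that(2), of \<beta>] \<beta>_gt_1 by linarith
    then have "t * x \<le> t * (\<beta> * C) * u'"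
      using mult_left_mono[OF _ t(1), of x "\<beta> * (C * u')"] by (simp add: mult.assoc)
    also have "\<dots> \<le> \<epsilon> * u'" using t(2) that(3) by (rule mult_right_mono)
    finally show ?thesis .
  qed
  show ?thesis
    using w t(1) unit_radius_comparable(3,4)[OF z y] unit_radius_pos[OF \<open>y \<in> bidisc\<close>]
    by (auto simp: cpolydisc_def intro!: short)
qed

lemma local_growth_imp_growth_on_cpolydisc:
  fixes J :: "complex \<times> complex \<Rightarrow> real"
  assumes step: "\<And>z w. z \<in> bidisc \<Longrightarrow> w \<in> cpolydisc z (\<epsilon> *\<^sub>R U z) \<Longrightarrow> J w \<le> K * J z"
    and "0 \<le> K" "0 < \<epsilon>" and N: "\<beta> * C / \<epsilon> \<le> real N"
    and z: "z \<in> bidisc" and w: "w \<in> cpolydisc z (\<beta> *\<^sub>R U z)"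
  shows "J w \<le> K ^ N * J z"
proof -
  define y where "y m = z + (real m / real N) *\<^sub>R (w - z)" for m
  have "0 < \<beta> * C / \<epsilon>" using \<beta>_gt_1 C_ge_1 \<open>0 < \<epsilon>\<close> by simp
  then have "0 < real N" using N by linarith
  have y_in: "y m \<in> cpolydisc z (\<beta> *\<^sub>R U z)" if "m \<le> N" for m
  proof -
    have "real m / real N * x \<le> x" if "0 \<le> x" for x
      using that \<open>m \<le> N\<close> \<open>0 < real N\<close> by (intro mult_left_le_one_le) auto
    then show ?thesis
      using w by (auto simp: y_def cpolydisc_def intro: order_trans[rotated])
  qed
  have "m \<le> N \<Longrightarrow> J (y m) \<le> K ^ m * J z" for m
  proof (induction m)
    case 0
    then show ?case by (simp add: y_def)
  next
    case (Suc m)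
    have y_m: "y m \<in> cpolydisc z (\<beta> *\<^sub>R U z)" using Suc.prems by (intro y_in) simp
    have "y (Suc m) = y m + (1 / real N) *\<^sub>R (w - z)"
      by (simp add: y_def add_divide_distrib algebra_simps)
    also have "\<dots> \<in> cpolydisc (y m) (\<epsilon> *\<^sub>R U (y m))"
      using N \<open>0 < \<epsilon>\<close> \<open>0 < real N\<close>
      by (intro short_segment_in_cpolydisc[OF z w y_m]) (auto simp: field_simps)
    finally have "J (y (Suc m)) \<le> K * J (y m)"
      using cpolydisc_subset_bidisc[OF z order_refl] y_m by (intro step) auto
    also have "\<dots> \<le> K * (K ^ m * J z)"
      using Suc \<open>0 \<le> K\<close> by (intro mult_left_mono) auto
    finally show ?case by (simp add: mult_ac)
  qed
  from this[of N] show ?thesis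
    using \<open>0 < real N\<close> by (simp add: y_def)
qed

lemma norm_le_jet_max_imp_bounded_index:
  assumes F: "analytic2 F bidisc"
    and le: "\<And>z w. z \<in> bidisc \<Longrightarrow> w \<in> cpolydisc z (\<beta> *\<^sub>R U z) \<Longrightarrow>
      norm (F w) \<le> A * jet_max F z (U z) n"
  shows "bounded_L_index_joint F l1 l2"
proof -
  obtain m where m: "A < \<beta> ^ m" using real_arch_pow[OF \<beta>_gt_1] by blast
  have "diag_max F z (U z) k \<le> jet_max F z (U z) (max n m)" if z: "z \<in> bidisc" for z k
  proof (cases "k \<le> max n m")
    case True
    then show ?thesis by (rule diag_max_le_jet_max)
  next
    case False
    let ?J = "jet_max F z (U z) n"
    have "0 \<le> ?J" using norm_le_jet_max norm_ge_zero order_trans by blast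
    have "\<beta> ^ k * diag_max F z (U z) k = diag_max F z (\<beta> *\<^sub>R U z) k"
      using \<beta>_gt_1 by (simp add: diag_max_scaleR)
    also have "\<dots> \<le> A * ?J"
      unfolding diag_max_le_iff
    proof (intro allI impI)
      fix p q
      show "monomial_size F z (\<beta> *\<^sub>R U z) p q \<le> A * ?J"
        using le[OF z] unit_radius_pos[OF z] \<beta>_gt_1 cpolydisc_subset_bidisc[OF z order_refl]
        by (intro monomial_size_Cauchy_inequality[OF F open_bidisc])
          (auto simp: torus2_def cpolydisc_def)
    qed
    also have "\<dots> \<le> \<beta> ^ k * ?J"
    proof (rule mult_right_mono)
      have "\<beta> ^ m \<le> \<beta> ^ k" using False \<beta>_gt_1 by (intro power_increasing) auto
      with m show "A \<le> \<beta> ^ k" by linarith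
    qed fact
    finally have "diag_max F z (U z) k \<le> ?J" using \<beta>_gt_1 by simp
    also have "\<dots> \<le> jet_max F z (U z) (max n m)" by (rule jet_max_mono_order) simp
    finally show ?thesis .
  qed
  then show ?thesis unfolding bounded_L_index_joint_iff by blast
qed

lemma main_polynomials_imp_bounded_index:
  assumes F: "analytic2 F bidisc" and \<eta>: "0 < \<eta>"
    and main: "\<And>z. z \<in> bidisc \<Longrightarrow>
      \<exists>r k0. \<eta> < r \<and> r < 1 \<and> k0 \<le> n \<and> main_polynomial F z (r *\<^sub>R U z) k0"
  shows "bounded_L_index_joint F l1 l2"
proof (rule norm_le_jet_max_imp_bounded_index[OF F])
  let ?K = "9 * (3 * C / \<eta>) ^ n" and ?J = "\<lambda>z. jet_max F z (U z) n"
  let ?N = "nat \<lceil>\<beta> * C / (\<eta> / 3)\<rceil>"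
  fix z w assume zw: "z \<in> bidisc" "w \<in> cpolydisc z (\<beta> *\<^sub>R U z)"
  have "norm (F w) \<le> ?J w" by (rule norm_le_jet_max)
  also have "\<dots> \<le> ?K ^ ?N * ?J z"
  proof (rule local_growth_imp_growth_on_cpolydisc[OF _ _ _ _ zw])
    show "?J w \<le> ?K * ?J z"
      if z: "z \<in> bidisc" and w: "w \<in> cpolydisc z ((\<eta> / 3) *\<^sub>R U z)" for z w
    proof -
      obtain r k0 where "\<eta> < r" "r < 1" "k0 \<le> n" "main_polynomial F z (r *\<^sub>R U z) k0"
        using main[OF z] by blast
      then show ?thesis
        using \<eta> by (intro jet_max_nearby_le[OF F z, where r = r]) (use w in auto)
    qed
  qed (use \<eta> C_ge_1 in \<open>auto intro: real_nat_ceiling_ge\<close>)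
  finally show "norm (F w) \<le> ?K ^ ?N * ?J z" .
qed

end

theorem theorem8:
  fixes \<beta> :: real and l1 l2 :: "complex \<times> complex \<Rightarrow> real" and F :: "complex \<times> complex \<Rightarrow> complex"
  assumes "\<beta> > 1"
    and "continuous_on bidisc l1" and "continuous_on bidisc l2"
    and "\<forall>z\<in>bidisc. l1 z > \<beta> / (1 - norm (fst z))"
    and "\<forall>z\<in>bidisc. l2 z > \<beta> / (1 - norm (snd z))"
    and "Q2 \<beta> l1 l2"
    and "analytic2 F bidisc"
  shows "bounded_L_index_joint F l1 l2 \<longleftrightarrow>
    (\<exists>p::nat. \<forall>d. 0 < d \<and> d \<le> \<beta> \<longrightarrow>
       (\<exists>\<eta>. 0 < \<eta> \<and> \<eta> < d \<and>
          (\<forall>z0\<in>bidisc. \<exists>r k0. \<eta> < r \<and> r < d \<and> k0 \<le> p \<and>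
              main_polynomial F z0 (r / l1 z0, r / l2 z0) k0)))"
proof -
  interpret admissible_weights \<beta> l1 l2
    using assms(1,4,5) by unfold_locales auto
  obtain C where "comparable_weights \<beta> l1 l2 C"
    using Q2_imp_comparable_weights[OF assms(6)] .
  then interpret comparable_weights \<beta> l1 l2 C .
  show ?thesis (is "?index \<longleftrightarrow> (\<exists>p. \<forall>d. 0 < d \<and> d \<le> \<beta> \<longrightarrow> ?radii p d)")
  proof
    assume ?index
    then have "\<exists>p. \<forall>d>0. ?radii p d"
      using bounded_index_imp_main_polynomials by (simp add: scaleR_unit_radius)
    then show "\<exists>p. \<forall>d. 0 < d \<and> d \<le> \<beta> \<longrightarrow> ?radii p d"
      by blast
  next
    assume "\<exists>p. \<forall>d. 0 < d \<and> d \<le> \<beta> \<longrightarrow> ?radii p d"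
    then obtain p where "\<forall>d. 0 < d \<and> d \<le> \<beta> \<longrightarrow> ?radii p d" ..
    from spec[OF this, of 1] assms(1) obtain \<eta> where "0 < \<eta>"
      "\<And>z. z \<in> bidisc \<Longrightarrow>
        \<exists>r k0. \<eta> < r \<and> r < 1 \<and> k0 \<le> p \<and> main_polynomial F z (r *\<^sub>R U z) k0"
      by (auto simp: scaleR_unit_radius)
    then show ?index
      by (rule main_polynomials_imp_bounded_index[OF assms(7)])
  qed
qed

end
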